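(* Consider theories satisfying the duality-invariance condition with non-trivial $\psi$. This condition is inconsistent with a theory independent of $p$. For a theory independent of $s$, it reduces to $$-p\left(\frac{\partial\mathcal{L}}{\partial p}\right)^2+\psi=p,$$ whose most general solution, up to a trivial overall sign, is $$\mathcal{L}_{\rm gBB}=\sqrt{(\psi-p)p}+\psi\arctan\left[\sqrt{\frac{p}{\psi-p}}\right]+\mathfrak{h}(\psi),$$ where $\mathfrak{h}$ is an arbitrary function of $\psi$ and where $p(\psi-p)\geq 0$ is required for reality of $\mathcal{L}_{\rm gBB}$. Thus, up to a trivial overall sign, $\mathcal{L}_{\rm gBB}$ is the most general duality-invariant theory of non-linear electrodynamics which is independent of $s$. As a result, it is the most general fixed point of the ModMax map (preserving duality invariance). Moreover: (a) the homogeneity condition $s\,\partial_s\mathcal{L}+p\,\partial_p\mathcal{L}+\psi\,\partial_\psi\mathcal{L}=\mathcal{L}$ is satisfied automatically by $\mathcal{L}_{\rm gBB}$ if $\mathfrak{h}$ is a linear function; (b) $\mathcal{L}_{\rm gBB}$ generalizes Bialynicki-Birula electrodynamics, whose Lagrangian $\mathcal{L}=i|p|$ (a topological term) is obtained from $\mathcal{L}_{\rm gBB}$ as $\psi\to0$; $\mathcal{L}_{\rm gBB}$ does not have a Maxwell limit; (c) with $y=p/\psi$, in the weak-field limit $1\gg y>0$ and disregarding the term $\mathfrak{h}(\psi)$, $$\mathcal{L}_{\rm gBB}=2\psi\sqrt{y}\left[1-\frac{y}{6}-\frac{y^2}{40}+\mathcal{O}(y^3)\right]\quad\text{for }\psi>0,$$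 $$\mathcal{L}_{\rm gBB}=\frac{2\psi y^{3/2}}{3}\left[1+\frac{3y}{10}+\frac{9y^2}{56}+\mathcal{O}(y^3)\right]\quad\text{for }\psi<0.$$
   Context: A theory of non-linear electrodynamics is given by a Lagrangian $\mathcal{L}$ that is a function of $s=-\frac14F_{ab}F^{ab}$ and $p=-\frac14F_{ab}(\star F)^{ab}$, with $F_{ab}$ the electromagnetic field strength and $(\star F)_{ab}=\frac12\varepsilon_{abcd}F^{cd}$, and which may also depend on a term $\psi$ independent of $F_{ab}$. It is duality-invariant if $$p\left(\frac{\partial\mathcal{L}}{\partial s}\right)^2-2s\,\frac{\partial\mathcal{L}}{\partial s}\frac{\partial\mathcal{L}}{\partial p}-p\left(\frac{\partial\mathcal{L}}{\partial p}\right)^2+\psi=p .$$ For $\gamma\in\mathbb{R}$ the ModMax map $\mathcal{M}_\gamma$ replaces every appearance of $s$ in $\mathcal{L}$ by $\cosh\gamma\;s+\sinh\gamma\,\sqrt{s^2+p^2}$, i.e. $$\mathcal{M}_\gamma(\mathcal{L})(s,p)=\mathcal{L}\big(\cosh\gamma\; s+\sinh\gamma\,\sqrt{s^2+p^2},\;p\big).$$ A fixed point of the ModMax map is a theory that remains invariant under its action. Maxwell theory is $\mathcal{L}=s$.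
   Formalization: For ψ<0 the stated formula (nonnegative roots, as in (c)) does not solve the reduced equation; there the general solution, theory and fixed point are given with the arctan term's sign reversed: √((ψ−p)p) − ψ arctan√(p/(ψ−p)) + h(ψ). *)

theory Defs
  imports "HOL-Analysis.Analysis" "HOL-Library.Landau_Symbols"
begin

text \<open>
  A Lagrangian is a real function of the two electromagnetic invariants \<open>s\<close>, \<open>p\<close> and of the
  field-independent quantity \<open>\<psi>\<close>, always in this order.
\<close>

type_synonym lagrangian = "real \<Rightarrow> real \<Rightarrow> real \<Rightarrow> real"

definition D\<^sub>s :: "lagrangian \<Rightarrow> lagrangian" where
  "D\<^sub>s L s p \<psi> = deriv (\<lambda>s'. L s' p \<psi>) s"

definition D\<^sub>p :: "lagrangian \<Rightarrow> lagrangian" where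
  "D\<^sub>p L s p \<psi> = deriv (\<lambda>p'. L s p' \<psi>) p"

definition D\<^sub>\<psi> :: "lagrangian \<Rightarrow> lagrangian" where
  "D\<^sub>\<psi> L s p \<psi> = deriv (\<lambda>\<psi>'. L s p \<psi>') \<psi>"

text \<open>
  Domains of definition. Only the slices at fixed \<open>\<psi>\<close> have to be open, so \<open>\<psi>\<close> may be a fixed
  constant as well as a variable. Connectedness of the slices and of the whole domain is what makes
  the integration ``constant'' a function of \<open>\<psi>\<close> alone and the overall sign a single one. The last
  clause says that \<open>\<psi>\<close> is non-trivial.
\<close>

definition nled_domain :: "(real \<times> real \<times> real) set \<Rightarrow> bool" where
  "nled_domain \<Omega> \<longleftrightarrow>
     \<Omega> \<noteq> {} \<and> connected \<Omega> \<and>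
     (\<forall>\<psi>. open {(s, p). (s, p, \<psi>) \<in> \<Omega>} \<and> connected {(s, p). (s, p, \<psi>) \<in> \<Omega>}) \<and>
     (\<forall>(s, p, \<psi>) \<in> \<Omega>. \<psi> \<noteq> 0)"

text \<open>
  Regularity is required only of the dependence on the field; without any condition on the
  dependence on \<open>\<psi>\<close>, an arbitrary function of \<open>\<psi>\<close> may be added to a Lagrangian.
\<close>

definition nled_theory :: "(real \<times> real \<times> real) set \<Rightarrow> lagrangian \<Rightarrow> bool" where
  "nled_theory \<Omega> L \<longleftrightarrow>
     (\<forall>(s, p, \<psi>) \<in> \<Omega>. (\<lambda>s'. L s' p \<psi>) field_differentiable at s \<and>
                      (\<lambda>p'. L s p' \<psi>) field_differentiable at p) \<and>
     continuous_on \<Omega> (\<lambda>(s, p, \<psi>). D\<^sub>s L s p \<psi>) \<and>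
     continuous_on \<Omega> (\<lambda>(s, p, \<psi>). D\<^sub>p L s p \<psi>)"

definition duality_invariant :: "(real \<times> real \<times> real) set \<Rightarrow> lagrangian \<Rightarrow> bool" where
  "duality_invariant \<Omega> L \<longleftrightarrow>
     (\<forall>(s, p, \<psi>) \<in> \<Omega>.
        p * (D\<^sub>s L s p \<psi>)\<^sup>2 - 2 * s * D\<^sub>s L s p \<psi> * D\<^sub>p L s p \<psi> - p * (D\<^sub>p L s p \<psi>)\<^sup>2 + \<psi> = p)"

definition independent_of_s :: "(real \<times> real \<times> real) set \<Rightarrow> lagrangian \<Rightarrow> bool" where
  "independent_of_s \<Omega> L \<longleftrightarrow> (\<exists>l. \<forall>(s, p, \<psi>) \<in> \<Omega>. L s p \<psi> = l p \<psi>)"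

definition independent_of_p :: "(real \<times> real \<times> real) set \<Rightarrow> lagrangian \<Rightarrow> bool" where
  "independent_of_p \<Omega> L \<longleftrightarrow> (\<exists>l. \<forall>(s, p, \<psi>) \<in> \<Omega>. L s p \<psi> = l s \<psi>)"

definition modmax :: "real \<Rightarrow> lagrangian \<Rightarrow> lagrangian" where
  "modmax \<gamma> L s p \<psi> = L (cosh \<gamma> * s + sinh \<gamma> * sqrt (s\<^sup>2 + p\<^sup>2)) p \<psi>"

definition modmax_domain :: "(real \<times> real \<times> real) set \<Rightarrow> bool" where
  "modmax_domain \<Omega> \<longleftrightarrow>
     (\<forall>\<gamma>. \<forall>(s, p, \<psi>) \<in> \<Omega>. (cosh \<gamma> * s + sinh \<gamma> * sqrt (s\<^sup>2 + p\<^sup>2), p, \<psi>) \<in> \<Omega>)"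

definition modmax_fixed_point :: "(real \<times> real \<times> real) set \<Rightarrow> lagrangian \<Rightarrow> bool" where
  "modmax_fixed_point \<Omega> L \<longleftrightarrow> (\<forall>\<gamma>. \<forall>(s, p, \<psi>) \<in> \<Omega>. modmax \<gamma> L s p \<psi> = L s p \<psi>)"

text \<open>
  \<open>gBB\<close> is the generalized Bialynicki-Birula Lagrangian with real square roots. With nonnegative
  real roots it solves \<open>- p (\<partial>\<^sub>p L)\<^sup>2 + \<psi> = p\<close> for \<open>\<psi> > 0\<close> only: for \<open>\<psi> < 0\<close> one has
  \<open>p, \<psi> - p < 0\<close>, the identity \<open>\<surd>(u v) = \<surd>u \<surd>v\<close> picks up a sign, and the two terms must be
  combined with the opposite relative sign, as in \<open>gBB_flip\<close>
  (see \<open>gBB_not_solution_negative\<close> below). At \<open>p = \<psi>\<close> both formulas involve a division by zero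
  and do not have the value obtained by continuity.
\<close>

definition gBB :: "(real \<Rightarrow> real) \<Rightarrow> real \<Rightarrow> real \<Rightarrow> real" where
  "gBB h p \<psi> = sqrt ((\<psi> - p) * p) + \<psi> * arctan (sqrt (p / (\<psi> - p))) + h \<psi>"

definition gBB_flip :: "(real \<Rightarrow> real) \<Rightarrow> real \<Rightarrow> real \<Rightarrow> real" where
  "gBB_flip h p \<psi> = sqrt ((\<psi> - p) * p) - \<psi> * arctan (sqrt (p / (\<psi> - p))) + h \<psi>"

text \<open>
  The same formulas with principal complex branches, needed outside \<open>p (\<psi> - p) \<ge> 0\<close>, where the
  roots of the real versions would be meaningless (\<open>sqrt\<close> is an odd function).
\<close>

definition gBB_complex :: "(real \<Rightarrow> real) \<Rightarrow> real \<Rightarrow> real \<Rightarrow> complex" where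
  "gBB_complex h p \<psi> =
     csqrt (of_real ((\<psi> - p) * p)) + of_real \<psi> * Arctan (csqrt (of_real (p / (\<psi> - p)))) + of_real (h \<psi>)"

definition gBB_flip_complex :: "(real \<Rightarrow> real) \<Rightarrow> real \<Rightarrow> real \<Rightarrow> complex" where
  "gBB_flip_complex h p \<psi> =
     csqrt (of_real ((\<psi> - p) * p)) - of_real \<psi> * Arctan (csqrt (of_real (p / (\<psi> - p)))) + of_real (h \<psi>)"

text \<open>
  \<open>L\<close> belongs to the family \<open>\<plusminus> G h\<close> on \<open>\<Omega>\<close>. The boundary points \<open>p = 0\<close> and \<open>p = \<psi>\<close> of the
  reality region \<open>p (\<psi> - p) \<ge> 0\<close> cannot occur, because the slices of a domain are open.
\<close>

definition in_family ::
    "((real \<Rightarrow> real) \<Rightarrow> real \<Rightarrow> real \<Rightarrow> real) \<Rightarrow> (real \<times> real \<times> real) set \<Rightarrow> lagrangian \<Rightarrow> bool" where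
  "in_family G \<Omega> L \<longleftrightarrow>
     (\<forall>(s, p, \<psi>) \<in> \<Omega>. p * (\<psi> - p) > 0) \<and>
     (\<exists>h. \<exists>\<sigma>\<in>{1, -1}. \<forall>(s, p, \<psi>) \<in> \<Omega>. L s p \<psi> = \<sigma> * G h p \<psi>)"

definition maxwell :: "real \<Rightarrow> real \<Rightarrow> real" where
  "maxwell s p = s"

definition bialynicki_birula :: "real \<Rightarrow> complex" where
  "bialynicki_birula p = \<i> * of_real \<bar>p\<bar>"

text \<open>
  A topological (theta) term: locally a constant multiple of \<open>p\<close>, which is a total derivative.
\<close>

definition topological_term :: "(real \<Rightarrow> complex) \<Rightarrow> bool" where
  "topological_term l \<longleftrightarrow>
     (\<forall>p\<^sub>0. p\<^sub>0 \<noteq> 0 \<longrightarrow> (\<exists>\<theta>. \<forall>\<^sub>F p in nhds p\<^sub>0. l p = \<theta> * of_real p))"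

text \<open>
  The family \<open>l\<close> of Lagrangians tends to Maxwell theory along \<open>F\<close>, for all field
  configurations in some open region.
\<close>

definition maxwell_limit :: "'i filter \<Rightarrow> ('i \<Rightarrow> real \<Rightarrow> real \<Rightarrow> complex) \<Rightarrow> bool" where
  "maxwell_limit F l \<longleftrightarrow>
     (\<exists>U. open U \<and> U \<noteq> {} \<and>
        (\<forall>(s, p) \<in> U. ((\<lambda>i. l i s p) \<longlongrightarrow> of_real (maxwell s p)) F))"

lemma gBB_not_solution_negative:
  fixes h :: "real \<Rightarrow> real"
  assumes "\<psi> < 0" "p * (\<psi> - p) > 0" "\<psi> \<noteq> 2 * p"
  shows "- p * (deriv (\<lambda>p'. gBB h p' \<psi>) p)\<^sup>2 + \<psi> \<noteq> p"
proof -
  have p: "p < 0" "\<psi> - p < 0"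
    using assms(1,2) by (auto simp: zero_less_mult_iff)
  define r where "r = sqrt (p / (\<psi> - p))"
  have pos: "p / (\<psi> - p) > 0" using p by (simp add: divide_neg_neg)
  have r: "r > 0" using pos by (simp add: r_def)
  have r2: "r\<^sup>2 = p / (\<psi> - p)" using pos by (simp add: r_def)
  define v where "v = \<psi> - p"
  have v: "v < 0" "\<psi> - p = v" using p by (simp_all add: v_def)
  have pv: "p = r\<^sup>2 * v" using r2 v by simp
  have psi: "\<psi> = v * (1 + r\<^sup>2)"
  proof -
    have "\<psi> = v + r\<^sup>2 * v" using pv v_def by linarith
    then show ?thesis by (simp add: algebra_simps)
  qed
  have root: "sqrt ((\<psi> - p) * p) = r * (p - \<psi>)"
  proof -
    have "(\<psi> - p) * p = (r * (- v))\<^sup>2"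
      unfolding v(2) by (subst pv) (simp add: power2_eq_square)
    moreover have "p - \<psi> = - v" by (simp add: v_def)
    ultimately show ?thesis using r v(1) by (simp add: abs_mult)
  qed
  have d: "((\<lambda>p'. gBB h p' \<psi>) has_real_derivative
      (\<psi> - 2 * p) / (2 * (r * (p - \<psi>))) +
      \<psi> * (1 / (1 + r\<^sup>2) * ((\<psi> / (\<psi> - p)\<^sup>2) / (2 * r)))) (at p)"
  proof -
    have q: "((\<lambda>p'. (\<psi> - p') * p') has_real_derivative \<psi> - 2 * p) (at p)"
      by (rule derivative_eq_intros refl)+ (simp add: algebra_simps)
    have f: "((\<lambda>p'. p' / (\<psi> - p')) has_real_derivative \<psi> / (\<psi> - p)\<^sup>2) (at p)"
      by (rule derivative_eq_intros refl)+ (use p in \<open>simp_all add: power2_eq_square\<close>)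
    have 1: "((\<lambda>p'. sqrt ((\<psi> - p') * p')) has_real_derivative
        inverse (sqrt ((\<psi> - p) * p)) / 2 * (\<psi> - 2 * p)) (at p)"
      by (rule DERIV_chain2[OF DERIV_real_sqrt q]) (use assms(2) in \<open>simp add: mult.commute\<close>)
    have 2: "((\<lambda>p'. sqrt (p' / (\<psi> - p'))) has_real_derivative
        inverse r / 2 * (\<psi> / (\<psi> - p)\<^sup>2)) (at p)"
      unfolding r_def by (rule DERIV_chain2[OF DERIV_real_sqrt[OF pos] f])
    have 3: "((\<lambda>p'. arctan (sqrt (p' / (\<psi> - p')))) has_real_derivative
        inverse (1 + r\<^sup>2) * (inverse r / 2 * (\<psi> / (\<psi> - p)\<^sup>2))) (at p)"
      using DERIV_chain2[OF DERIV_arctan 2] by (simp only: r_def)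
    have 4: "((\<lambda>p'. gBB h p' \<psi>) has_real_derivative
        inverse (sqrt ((\<psi> - p) * p)) / 2 * (\<psi> - 2 * p) +
        \<psi> * (inverse (1 + r\<^sup>2) * (inverse r / 2 * (\<psi> / (\<psi> - p)\<^sup>2))) + 0) (at p)"
      unfolding gBB_def by (intro DERIV_add DERIV_cmult 1 3 DERIV_const)
    then show ?thesis
      unfolding root
      by (simp only: divide_inverse inverse_mult_distrib add_0_right mult_1_left mult_ac)
  qed
  have "(\<psi> - 2 * p) / (2 * (r * (p - \<psi>))) +
      \<psi> * (1 / (1 + r\<^sup>2) * ((\<psi> / (\<psi> - p)\<^sup>2) / (2 * r))) = r"
  proof -
    have n: "1 + r\<^sup>2 > 0" by (simp add: add_pos_nonneg)
    have a: "(\<psi> - 2 * p) / (2 * (r * (p - \<psi>))) = (r\<^sup>2 - 1) / (2 * r)"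
    proof -
      have "\<psi> - 2 * p = v * (1 - r\<^sup>2)" "p - \<psi> = - v"
      proof -
        have "v * (1 - r\<^sup>2) = v - r\<^sup>2 * v" by (simp add: algebra_simps)
        then show "\<psi> - 2 * p = v * (1 - r\<^sup>2)" "p - \<psi> = - v"
          using pv v_def by linarith+
      qed
      moreover have "v * (1 - r\<^sup>2) / (2 * (r * (- v))) = (r\<^sup>2 - 1) / (2 * r)"
        using v(1) r by (simp add: field_simps)
      ultimately show ?thesis by (simp only:)
    qed
    have b: "\<psi> * (1 / (1 + r\<^sup>2) * ((\<psi> / (\<psi> - p)\<^sup>2) / (2 * r))) = (1 + r\<^sup>2) / (2 * r)"
    proof -
      have "\<psi> * (1 / (1 + r\<^sup>2)) = v" using n by (subst psi) simp
      moreover have "\<psi> / (\<psi> - p)\<^sup>2 = (1 + r\<^sup>2) / v"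
        unfolding v(2) using v(1) by (subst psi) (simp add: power2_eq_square)
      ultimately have "\<psi> * (1 / (1 + r\<^sup>2) * ((\<psi> / (\<psi> - p)\<^sup>2) / (2 * r))) =
          v * ((1 + r\<^sup>2) / v / (2 * r))"
        by (simp only: mult.assoc[symmetric])
      then show ?thesis using v(1) by simp
    qed
    show ?thesis unfolding a b using r by (simp add: field_simps power2_eq_square)
  qed
  with d have D: "deriv (\<lambda>p'. gBB h p' \<psi>) p = r"
    by (metis DERIV_imp_deriv)
  have "- p * r\<^sup>2 + \<psi> \<noteq> p"
  proof
    assume "- p * r\<^sup>2 + \<psi> = p"
    then have "\<psi> - p = p * r\<^sup>2" by linarith
    moreover have "r\<^sup>2 * (\<psi> - p) = p" using r2 p by simp
    ultimately have "(\<psi> - p) * (\<psi> - p) = p * p" by (metis mult.assoc mult.commute)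
    then have "\<psi> * (\<psi> - 2 * p) = 0" by (simp add: algebra_simps)
    then show False using assms by simp
  qed
  then show ?thesis by (simp add: D)
qed

end

theory Submission
  imports Defs "HOL-Real_Asymp.Real_Asymp"
begin

text \<open>
  If \<open>L\<close> is independent of \<open>s\<close>, duality invariance says \<open>(\<partial>\<^sub>p L)\<^sup>2 = (\<psi> - p) / p\<close>. The right-hand side
  is nonnegative near every point of an open slice, which excludes \<open>p = \<psi>\<close>, so \<open>\<partial>\<^sub>p L\<close> has no zero
  and hence one sign on the connected domain; integrating along the connected slices leaves a
  constant that depends on \<open>\<psi>\<close> alone. The ModMax map is the boost \<open>t \<mapsto> t + \<gamma>\<close> in the
  parametrization \<open>s = \<bar>p\<bar> sinh t\<close>, so for \<open>p \<noteq> 0\<close> its orbits are transitive in \<open>s\<close> and its fixed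
  points are exactly the theories independent of \<open>s\<close>. Outside the reality region the argument of the
  arctangent is imaginary, \<open>\<i> t\<close>, and the imaginary part of the Lagrangian is controlled by
  \<open>ln x < (x - 1 / x) / 2\<close> with \<open>x = \<bar>(1 + t) / (1 - t)\<bar>\<close>.
\<close>

section \<open>A logarithm bound, and the derivatives of the signed Lagrangian\<close>

text \<open>The function \<open>x - 1 / x - 2 * ln x\<close> vanishes at 1 and has derivative
  \<open>(1 - 1 / x)\<^sup>2\<close>.\<close>

lemma ln_less_half_diff_inverse: "ln x < (x - 1 / x) / 2" if "1 < x" for x :: real
proof -
  have "(1 - 1 / 1 - 2 * ln 1 :: real) < x - 1 / x - 2 * ln x"
  proof (rule DERIV_pos_imp_increasing_open[OF that])
    fix y :: real assume y: "1 < y"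
    have "((\<lambda>x. x - 1 / x - 2 * ln x) has_real_derivative (1 - 1 / y)\<^sup>2) (at y)"
      using y by (auto intro!: derivative_eq_intros simp: field_simps power2_eq_square)
    moreover have "(1 - 1 / y)\<^sup>2 > 0" using y by simp
    ultimately show "\<exists>d. ((\<lambda>x. x - 1 / x - 2 * ln x) has_real_derivative d) (at y) \<and> 0 < d"
      by blast
  qed (auto intro!: continuous_intros)
  then show ?thesis by simp
qed

text \<open>
  The reduced condition is solved by the choice \<open>e = sgn \<psi>\<close>.
\<close>

definition gBB_signed :: "real \<Rightarrow> (real \<Rightarrow> real) \<Rightarrow> real \<Rightarrow> real \<Rightarrow> real" where
  "gBB_signed e h p \<psi> =
     sqrt ((\<psi> - p) * p) + e * (\<psi> * arctan (sqrt (p / (\<psi> - p)))) + h \<psi>"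

lemma gBB_eq_signed: "gBB = gBB_signed 1"
  and gBB_flip_eq_signed: "gBB_flip = gBB_signed (- 1)"
  by (simp_all add: fun_eq_iff gBB_def gBB_flip_def gBB_signed_def)

text \<open>These are the outer chain-rule factors of \<open>arctan (sqrt q)\<close> at
  \<open>q = p / (\<psi> - p)\<close>. The \<open>p\<close>- and \<psi>-derivatives share them and
  differ in the derivative of \<open>q\<close>, so they can stay unevaluated in the homogeneity
  identity, where they cancel.\<close>

definition arctan_slope :: "real \<Rightarrow> real \<Rightarrow> real" where
  "arctan_slope p \<psi> = inverse (1 + p / (\<psi> - p)) * (inverse (sqrt (p / (\<psi> - p))) / 2)"

lemma arctan_sqrt_has_real_derivative:
  assumes "(q has_real_derivative d) (at x)" "q x > 0"
  shows "((\<lambda>x. arctan (sqrt (q x))) has_real_derivative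
           inverse (1 + q x) * (inverse (sqrt (q x)) / 2) * d) (at x)"
  using DERIV_chain2[OF DERIV_arctan DERIV_chain2[OF DERIV_real_sqrt[OF assms(2)] assms(1)]] assms(2)
  by (simp add: mult_ac)

lemma gBB_signed_derivs:
  assumes pos: "p * (\<psi> - p) > 0"
  shows gBB_signed_deriv_p:
      "((\<lambda>p. gBB_signed e h p \<psi>) has_real_derivative
         (\<psi> - 2 * p) / (2 * sqrt ((\<psi> - p) * p)) +
         e * (\<psi> * (arctan_slope p \<psi> * (\<psi> / (\<psi> - p)\<^sup>2)))) (at p)"
    and gBB_signed_deriv_psi:
      "(h has_real_derivative h') (at \<psi>) \<Longrightarrow>
       ((\<lambda>\<psi>. gBB_signed e h p \<psi>) has_real_derivative
         p / (2 * sqrt ((\<psi> - p) * p)) +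
         e * (arctan (sqrt (p / (\<psi> - p))) + \<psi> * (arctan_slope p \<psi> * (- p / (\<psi> - p)\<^sup>2))) + h') (at \<psi>)"
proof -
  have pos': "p / (\<psi> - p) > 0" "(\<psi> - p) * p > 0" "\<psi> - p \<noteq> 0"
    using pos by (auto simp: zero_less_divide_iff zero_less_mult_iff)
  have q1: "((\<lambda>p'. (\<psi> - p') * p') has_real_derivative \<psi> - 2 * p) (at p)"
    by (auto intro!: derivative_eq_intros)
  have f1: "((\<lambda>p'. p' / (\<psi> - p')) has_real_derivative \<psi> / (\<psi> - p)\<^sup>2) (at p)"
    using pos' by (auto intro!: derivative_eq_intros simp: power2_eq_square)
  have q2: "((\<lambda>\<psi>. (\<psi> - p) * p) has_real_derivative p) (at \<psi>)"
    by (auto intro!: derivative_eq_intros)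
  have f2: "((\<lambda>\<psi>. p / (\<psi> - p)) has_real_derivative - p / (\<psi> - p)\<^sup>2) (at \<psi>)"
    using pos' by (auto intro!: derivative_eq_intros simp: power2_eq_square)
  show "((\<lambda>p. gBB_signed e h p \<psi>) has_real_derivative
         (\<psi> - 2 * p) / (2 * sqrt ((\<psi> - p) * p)) +
         e * (\<psi> * (arctan_slope p \<psi> * (\<psi> / (\<psi> - p)\<^sup>2)))) (at p)"
    unfolding gBB_signed_def arctan_slope_def
    by (rule DERIV_cong, (rule DERIV_add DERIV_cmult DERIV_const
          arctan_sqrt_has_real_derivative[OF f1 pos'(1)]
          DERIV_chain2[OF DERIV_real_sqrt[OF pos'(2)] q1])+) (simp add: field_simps)
  show "((\<lambda>\<psi>. gBB_signed e h p \<psi>) has_real_derivative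
         p / (2 * sqrt ((\<psi> - p) * p)) +
         e * (arctan (sqrt (p / (\<psi> - p))) + \<psi> * (arctan_slope p \<psi> * (- p / (\<psi> - p)\<^sup>2))) + h') (at \<psi>)"
    if "(h has_real_derivative h') (at \<psi>)"
    unfolding gBB_signed_def arctan_slope_def
    by (rule DERIV_cong, (rule DERIV_add DERIV_cmult DERIV_mult DERIV_ident that
          arctan_sqrt_has_real_derivative[OF f2 pos'(1)]
          DERIV_chain2[OF DERIV_real_sqrt[OF pos'(2)] q2])+) (simp add: field_simps)
qed

text \<open>Here \<open>p\<close> and \<open>\<psi> - p\<close> both have the sign \<open>e\<close>
  of \<psi>, so the roots of quotients become \<open>R / (e * (\<psi> - p))\<close> and
  \<open>R / (e * p)\<close>, with \<open>R\<close> the root of the product. The arctangent term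
  then contributes \<open>e * e * \<psi> / (2 * R)\<close>, and \<open>e * e = 1\<close> makes the
  numerators add up to \<open>2 * (\<psi> - p)\<close>.\<close>

lemma gBB_signed_slope:
  assumes e: "e \<in> {1, -1}" and sgn: "e * \<psi> > 0" and pos: "p * (\<psi> - p) > 0"
  shows "((\<lambda>p. gBB_signed e h p \<psi>) has_real_derivative e * sqrt ((\<psi> - p) / p)) (at p)"
proof (rule DERIV_cong[OF gBB_signed_deriv_p[OF pos]])
  define R where "R = sqrt ((\<psi> - p) * p)"
  have R: "R > 0" "R\<^sup>2 = (\<psi> - p) * p"
    using pos by (simp_all add: R_def mult.commute)
  have ne: "p \<noteq> 0" "\<psi> - p \<noteq> 0" "\<psi> \<noteq> 0"
    using pos sgn by auto
  have pe: "e * p > 0" "e * (\<psi> - p) > 0"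
    using e sgn pos by (auto simp: zero_less_mult_iff)
  have e2: "e * e = 1" using e by auto
  have q: "sqrt (p / (\<psi> - p)) = R / (e * (\<psi> - p))"
  proof (rule real_sqrt_unique)
    show "(R / (e * (\<psi> - p)))\<^sup>2 = p / (\<psi> - p)"
      using ne e2 by (simp add: power_divide power_mult_distrib R(2)) (simp add: power2_eq_square)
  qed (use R pe in simp)
  have q': "sqrt ((\<psi> - p) / p) = R / (e * p)"
  proof (rule real_sqrt_unique)
    show "(R / (e * p))\<^sup>2 = (\<psi> - p) / p"
      using ne e2 by (simp add: power_divide power_mult_distrib R(2)) (simp add: power2_eq_square)
  qed (use R pe in simp)
  have K: "arctan_slope p \<psi> = (\<psi> - p) / \<psi> * (e * (\<psi> - p) / R / 2)"
    using ne unfolding arctan_slope_def q by (simp add: divide_simps)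
  have K': "arctan_slope p \<psi> * (\<psi> / (\<psi> - p)\<^sup>2) = e / (2 * R)"
    unfolding K power2_eq_square times_divide_times_eq
    by (subst frac_eq_eq) (use ne R in \<open>auto simp: mult_ac\<close>)
  have "e * (\<psi> * (arctan_slope p \<psi> * (\<psi> / (\<psi> - p)\<^sup>2))) = (e * e) * \<psi> / (2 * R)"
    unfolding K' by simp
  moreover have "e * (R / (e * p)) = (\<psi> - p) / R"
  proof -
    have "e * (R / (e * p)) = R / p" using e by auto
    also have "\<dots> = (\<psi> - p) / R" using ne R by (simp add: field_simps power2_eq_square)
    finally show ?thesis .
  qed
  moreover have "(\<psi> - 2 * p) / (2 * R) + \<psi> / (2 * R) = (\<psi> - p) / R"
    using R(1) by (simp add: field_simps)
  ultimately show "(\<psi> - 2 * p) / (2 * sqrt ((\<psi> - p) * p)) +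
         e * (\<psi> * (arctan_slope p \<psi> * (\<psi> / (\<psi> - p)\<^sup>2))) = e * sqrt ((\<psi> - p) / p)"
    unfolding q' R_def[symmetric] e2 by simp
qed

text \<open>This is Euler's identity in degree one: the root and a linear \<open>h\<close> have
  degree one, and the argument of the arctangent has degree zero. Hence the arctangent slopes cancel
  between the \<open>p\<close>- and \<psi>-derivatives, for either sign \<open>e\<close>.\<close>

lemma gBB_signed_homogeneous:
  assumes "linear h" and pos: "p * (\<psi> - p) > 0" and L: "L = (\<lambda>s. gBB_signed e h)"
  shows "(\<lambda>s'. L s' p \<psi>) field_differentiable at s \<and>
         (\<lambda>p'. L s p' \<psi>) field_differentiable at p \<and>
         (\<lambda>\<psi>'. L s p \<psi>') field_differentiable at \<psi> \<and>
         s * D\<^sub>s L s p \<psi> + p * D\<^sub>p L s p \<psi> + \<psi> * D\<^sub>\<psi> L s p \<psi> = L s p \<psi>"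
proof -
  define c where "c = h 1"
  have h: "h = (\<lambda>x. x * c)"
  proof
    fix x show "h x = x * c"
      unfolding c_def using linear_scale[OF assms(1), of x 1] by simp
  qed
  have h': "(h has_real_derivative c) (at \<psi>)"
    unfolding h by (auto intro!: derivative_eq_intros)
  note dp = gBB_signed_deriv_p[OF pos, of e h]
  note d\<psi> = gBB_signed_deriv_psi[OF pos h', of e]
  define R where "R = sqrt ((\<psi> - p) * p)"
  have R: "R > 0" "R * R = (\<psi> - p) * p"
    using pos by (simp_all add: R_def mult.commute)
  have "p * ((\<psi> - 2 * p) / (2 * R)) + \<psi> * (p / (2 * R)) = R"
    using R by (simp add: field_simps)
  then have "p * D\<^sub>p L s p \<psi> + \<psi> * D\<^sub>\<psi> L s p \<psi> = L s p \<psi>"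
    unfolding D\<^sub>p_def D\<^sub>\<psi>_def L DERIV_imp_deriv[OF dp] DERIV_imp_deriv[OF d\<psi>]
    unfolding gBB_signed_def R_def[symmetric] h
    by (simp add: algebra_simps)
  moreover have "D\<^sub>s L s p \<psi> = 0" by (simp add: D\<^sub>s_def L)
  ultimately show ?thesis
    using dp d\<psi> by (auto simp: L field_differentiable_def)
qed

section \<open>Open slices, and Lagrangians independent of one invariant\<close>

text \<open>An identity on \<open>\<Omega>\<close> thus holds near each point along \<open>s\<close>
  and along \<open>p\<close>, so partial derivatives may be computed from it.\<close>

lemma nled_domain_eventually:
  assumes "nled_domain \<Omega>" "(s, p, \<psi>) \<in> \<Omega>"
  shows nled_domain_eventually_s: "\<forall>\<^sub>F s' in nhds s. (s', p, \<psi>) \<in> \<Omega>"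
    and nled_domain_eventually_p: "\<forall>\<^sub>F p' in nhds p. (s, p', \<psi>) \<in> \<Omega>"
proof -
  let ?S = "{(s, p). (s, p, \<psi>) \<in> \<Omega>}"
  have S: "open ?S" using assms(1) by (simp add: nled_domain_def)
  have "open ((\<lambda>s'. (s', p)) -` ?S)" "open ((\<lambda>p'. (s, p')) -` ?S)"
    by (rule open_vimage[OF S]; intro continuous_intros)+
  from eventually_nhds_in_open[OF this(1), of s] eventually_nhds_in_open[OF this(2), of p] assms(2)
  show "\<forall>\<^sub>F s' in nhds s. (s', p, \<psi>) \<in> \<Omega>" "\<forall>\<^sub>F p' in nhds p. (s, p', \<psi>) \<in> \<Omega>"
    by simp_all
qed

lemma independent_of_sE:
  assumes "independent_of_s \<Omega> L"
  obtains l where "\<And>s p \<psi>. (s, p, \<psi>) \<in> \<Omega> \<Longrightarrow> L s p \<psi> = l p \<psi>"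
proof -
  from assms obtain l where "\<forall>(s, p, \<psi>)\<in>\<Omega>. L s p \<psi> = l p \<psi>"
    unfolding independent_of_s_def by blast
  then show ?thesis by (intro that[of l]) auto
qed

lemma D_s_eq_0_if_independent_of_s:
  assumes "nled_domain \<Omega>" "independent_of_s \<Omega> L" "(s, p, \<psi>) \<in> \<Omega>"
  shows "((\<lambda>s'. L s' p \<psi>) has_real_derivative 0) (at s)" "D\<^sub>s L s p \<psi> = 0"
proof -
  obtain l where l: "\<And>s p \<psi>. (s, p, \<psi>) \<in> \<Omega> \<Longrightarrow> L s p \<psi> = l p \<psi>"
    using assms(2) by (rule independent_of_sE) blast
  have "\<forall>\<^sub>F s' in nhds s. L s' p \<psi> = l p \<psi>"
    using nled_domain_eventually_s[OF assms(1,3)] by eventually_elim (rule l)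
  from DERIV_cong_ev[OF refl this refl]
  show "((\<lambda>s'. L s' p \<psi>) has_real_derivative 0) (at s)" by simp
  then show "D\<^sub>s L s p \<psi> = 0" by (simp add: D\<^sub>s_def DERIV_imp_deriv)
qed

lemma duality_invariant_iff_reduced:
  assumes "\<And>s p \<psi>. (s, p, \<psi>) \<in> \<Omega> \<Longrightarrow> D\<^sub>s L s p \<psi> = 0"
  shows "duality_invariant \<Omega> L \<longleftrightarrow> (\<forall>(s, p, \<psi>) \<in> \<Omega>. - p * (D\<^sub>p L s p \<psi>)\<^sup>2 + \<psi> = p)"
  unfolding duality_invariant_def by (rule ball_cong[OF refl]) (clarsimp simp: assms)

text \<open>At fixed \<open>s\<close> and \<psi> the condition reads
  \<open>p * (l'\<^sup>2 - 1) = - \<psi>\<close>, with \<open>l'\<close> not depending on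
  \<open>p\<close>. Two different values of \<open>p\<close> in the open slice force
  \<open>l'\<^sup>2 = 1\<close>, hence \<open>\<psi> = 0\<close>, which the domain excludes.\<close>

lemma not_duality_invariant_if_independent_of_p:
  assumes dom: "nled_domain \<Omega>" and ind: "independent_of_p \<Omega> L"
  shows "\<not> duality_invariant \<Omega> L"
proof
  assume inv: "duality_invariant \<Omega> L"
  obtain s p \<psi> where x: "(s, p, \<psi>) \<in> \<Omega>" using dom by (auto simp: nled_domain_def)
  obtain l where l: "\<And>s p \<psi>. (s, p, \<psi>) \<in> \<Omega> \<Longrightarrow> L s p \<psi> = l s \<psi>"
    using ind unfolding independent_of_p_def by force
  have eq: "p' * ((deriv (\<lambda>s. l s \<psi>) s)\<^sup>2 - 1) = - \<psi>" if y: "(s, p', \<psi>) \<in> \<Omega>" for p'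
  proof -
    have "\<forall>\<^sub>F s' in nhds s. L s' p' \<psi> = l s' \<psi>"
      using nled_domain_eventually_s[OF dom y] by eventually_elim (rule l)
    then have Ds: "D\<^sub>s L s p' \<psi> = deriv (\<lambda>s. l s \<psi>) s"
      unfolding D\<^sub>s_def by (rule deriv_cong_ev) simp
    have "\<forall>\<^sub>F p'' in nhds p'. L s p'' \<psi> = l s \<psi>"
      using nled_domain_eventually_p[OF dom y] by eventually_elim (rule l)
    then have "D\<^sub>p L s p' \<psi> = deriv (\<lambda>_. l s \<psi>) p'"
      unfolding D\<^sub>p_def by (rule deriv_cong_ev) simp
    then have "D\<^sub>p L s p' \<psi> = 0" by simp
    with inv y Ds have "p' * (deriv (\<lambda>s. l s \<psi>) s)\<^sup>2 + \<psi> = p'"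
      by (fastforce simp: duality_invariant_def)
    then show ?thesis by (simp add: algebra_simps)
  qed
  obtain d where d: "d > 0" "\<And>p'. dist p' p < d \<Longrightarrow> (s, p', \<psi>) \<in> \<Omega>"
    using nled_domain_eventually_p[OF dom x] by (auto simp: eventually_nhds_metric)
  have "(s, p + d / 2, \<psi>) \<in> \<Omega>" using d by (auto simp: dist_norm)
  from eq[OF this] eq[OF x] have "d / 2 * ((deriv (\<lambda>s. l s \<psi>) s)\<^sup>2 - 1) = 0"
    by (simp only: distrib_right)
  with d have "(deriv (\<lambda>s. l s \<psi>) s)\<^sup>2 - 1 = 0" by simp
  with eq[OF x] have "\<psi> = 0" by simp
  with x dom show False by (auto simp: nled_domain_def)
qed

section \<open>General solution of the reduced condition\<close>

text \<open>The condition makes \<open>p * (\<psi> - p)\<close> the square of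
  \<open>p * D\<^sub>p L s p \<psi>\<close>. The value zero is excluded: \<open>p = 0\<close> would
  give \<open>\<psi> = 0\<close>, and at \<open>p = \<psi>\<close> the open slice contains nearby
  points where the product is negative.\<close>

lemma reduced_condition_imp_real:
  assumes dom: "nled_domain \<Omega>"
    and red: "\<forall>(s, p, \<psi>) \<in> \<Omega>. - p * (D\<^sub>p L s p \<psi>)\<^sup>2 + \<psi> = p"
    and x: "(s, p, \<psi>) \<in> \<Omega>"
  shows "p * (\<psi> - p) > 0"
proof -
  have nonneg: "p' * (\<psi> - p') \<ge> 0" if y: "(s, p', \<psi>) \<in> \<Omega>" for p'
  proof -
    have "\<psi> - p' = p' * (D\<^sub>p L s p' \<psi>)\<^sup>2" using red y by force
    then have "p' * (\<psi> - p') = (p' * D\<^sub>p L s p' \<psi>)\<^sup>2"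
      by (simp add: power2_eq_square mult_ac)
    then show ?thesis by simp
  qed
  have \<psi>: "\<psi> \<noteq> 0" using dom x by (auto simp: nled_domain_def)
  have p: "p \<noteq> 0" using red x \<psi> by force
  have "p \<noteq> \<psi>"
  proof
    assume "p = \<psi>"
    then have [simp]: "\<psi> = p" by simp
    obtain d where d: "d > 0" "\<And>p'. dist p' p < d \<Longrightarrow> (s, p', \<psi>) \<in> \<Omega>"
      using nled_domain_eventually_p[OF dom x] by (auto simp: eventually_nhds_metric)
    \<comment> \<open>The step leads away from 0, beyond \<psi>, so that \<open>p'\<close> and
      \<open>p - p'\<close> have opposite signs.\<close>
    define p' where "p' = p + sgn p * (d / 2)"
    have "dist p' p < d" using d(1) p by (simp add: p'_def dist_norm abs_mult abs_sgn_eq)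
    then have "0 \<le> p' * (p - p')" using nonneg[OF d(2)] by simp
    also have "p' * (p - p') = - (p * sgn p * (d / 2) + sgn p * sgn p * (d / 2)\<^sup>2)"
      by (simp add: p'_def algebra_simps power2_eq_square)
    finally have "p * sgn p * (d / 2) + sgn p * sgn p * (d / 2)\<^sup>2 \<le> 0" by simp
    moreover have "p * sgn p > 0" "sgn p * sgn p > 0" using p by (auto simp: sgn_if)
    then have "p * sgn p * (d / 2) > 0" "sgn p * sgn p * (d / 2)\<^sup>2 > 0"
      using d(1) by (metis mult_pos_pos half_gt_zero zero_less_power)+
    ultimately show False by linarith
  qed
  with p have "p * (\<psi> - p) \<noteq> 0" by simp
  with nonneg[OF x] show ?thesis by linarith
qed

text \<open>By the intermediate value property a change of sign would produce a zero. Applied to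
  \<open>D\<^sub>p L\<close> on all of \<open>\<Omega>\<close>, this gives one overall sign for
  every \<psi> at once.\<close>

lemma connected_nonzero_imp_sign:
  fixes f :: "'a :: topological_space \<Rightarrow> real"
  assumes "connected S" "continuous_on S f" "\<And>x. x \<in> S \<Longrightarrow> f x \<noteq> 0"
  obtains \<sigma> where "\<sigma> \<in> {1, -1}" "\<And>x. x \<in> S \<Longrightarrow> \<sigma> * f x > 0"
proof (cases "\<exists>x\<in>S. f x > 0")
  case True
  then obtain x where x: "x \<in> S" "f x > 0" by blast
  have "f y > 0" if y: "y \<in> S" for y
  proof (rule ccontr)
    assume "\<not> f y > 0"
    then have "0 \<in> f ` S"
      using connectedD_interval[OF connected_continuous_image[OF assms(2,1)], of "f y" "f x" 0] x y
      by simp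
    with assms(3) show False by auto
  qed
  then show ?thesis using that[of 1] by simp
next
  case False
  then have "f x < 0" if "x \<in> S" for x using assms(3)[OF that] that by fastforce
  then show ?thesis using that[of "-1"] by simp
qed

text \<open>The section of \<open>S\<close> at fixed \<open>s\<close> need not be an interval, so
  integrating along \<open>p\<close> alone does not suffice. In a small box one moves along
  \<open>p\<close> by the zero derivative and along \<open>s\<close> by \<open>ind\<close>;
  connectedness of \<open>S\<close> makes the local constants agree.\<close>

lemma constant_on_if_partials_vanish:
  fixes f :: "real \<Rightarrow> real \<Rightarrow> real"
  assumes S: "open S" "connected S"
    and ind: "\<And>s s' p. (s, p) \<in> S \<Longrightarrow> (s', p) \<in> S \<Longrightarrow> f s p = f s' p"
    and flat: "\<And>s p. (s, p) \<in> S \<Longrightarrow> ((\<lambda>p. f s p) has_real_derivative 0) (at p)"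
  shows "(\<lambda>(s, p). f s p) constant_on S"
proof (rule locally_constant_imp_constant[OF S(2)])
  fix a assume "a \<in> S"
  then obtain s p where a: "a = (s, p)" "(s, p) \<in> S" by (cases a) auto
  obtain A B where AB: "open A" "open B" "s \<in> A" "p \<in> B" "A \<times> B \<subseteq> S"
    using open_prod_elim[OF S(1) a(2)] by (metis mem_Sigma_iff)
  obtain d where d: "d > 0" "ball p d \<subseteq> B" using AB by (meson openE)
  have loc: "f s' p' = f s p" if "(s', p') \<in> A \<times> ball p d" for s' p'
  proof -
    have mem: "(s', p') \<in> S" "(s, q) \<in> S" if "q \<in> ball p d" for q
      using AB d \<open>(s', p') \<in> A \<times> ball p d\<close> that by auto
    have "\<exists>c. \<forall>q\<in>ball p d. f s q = c"
      by (rule has_field_derivative_zero_constant)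
         (auto intro!: has_field_derivative_at_within flat mem)
    then have "f s p' = f s p" using d that by auto
    with ind[OF mem(1) mem(2)] that show ?thesis by auto
  qed
  have "openin (top_of_set S) (A \<times> ball p d)"
    using AB d by (intro open_subset) (auto intro: open_Times)
  then show "\<exists>T. openin (top_of_set S) T \<and> a \<in> T \<and>
      (\<forall>x\<in>T. (case x of (s, p) \<Rightarrow> f s p) = (case a of (s, p) \<Rightarrow> f s p))"
    unfolding a(1) using AB(3) d(1)
    by (intro exI[of _ "A \<times> ball p d"]) (clarsimp, metis loc SigmaI mem_ball)
qed

text \<open>The slope of \<open>L\<close> in \<open>p\<close> is a root of
  \<open>(\<psi> - p) / p\<close> with one sign throughout \<open>\<Omega>\<close>. Subtracting the
  explicit solution with that slope leaves a function that is constant on each slice.\<close>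

lemma reduced_condition_imp_in_family:
  assumes dom: "nled_domain \<Omega>" and e: "e \<in> {1, -1}" and sgn: "\<forall>(s, p, \<psi>) \<in> \<Omega>. e * \<psi> > 0"
    and th: "nled_theory \<Omega> L" and ind: "independent_of_s \<Omega> L"
    and red: "\<forall>(s, p, \<psi>) \<in> \<Omega>. - p * (D\<^sub>p L s p \<psi>)\<^sup>2 + \<psi> = p"
  shows "in_family (gBB_signed e) \<Omega> L"
proof -
  have real: "p * (\<psi> - p) > 0" if "(s, p, \<psi>) \<in> \<Omega>" for s p \<psi>
    using reduced_condition_imp_real[OF dom red that] .
  have D2: "(D\<^sub>p L s p \<psi>)\<^sup>2 = (\<psi> - p) / p" if x: "(s, p, \<psi>) \<in> \<Omega>" for s p \<psi>
  proof -
    have "p * (D\<^sub>p L s p \<psi>)\<^sup>2 = \<psi> - p" using red x by force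
    moreover have "p \<noteq> 0" using real[OF x] by auto
    ultimately show ?thesis by (metis nonzero_mult_div_cancel_left)
  qed
  obtain \<tau> where \<tau>: "\<tau> \<in> {1, -1}" "\<And>s p \<psi>. (s, p, \<psi>) \<in> \<Omega> \<Longrightarrow> \<tau> * D\<^sub>p L s p \<psi> > 0"
  proof (rule connected_nonzero_imp_sign)
    show "connected \<Omega>" using dom by (simp add: nled_domain_def)
    show "continuous_on \<Omega> (\<lambda>(s, p, \<psi>). D\<^sub>p L s p \<psi>)" using th by (simp add: nled_theory_def)
    show "(case x of (s, p, \<psi>) \<Rightarrow> D\<^sub>p L s p \<psi>) \<noteq> 0" if "x \<in> \<Omega>" for x
      using that D2 real by (fastforce split: prod.splits)
  qed fastforce
  \<comment> \<open>\<open>\<tau>\<close> is the sign of \<open>D\<^sub>p L\<close>, while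
    \<open>gBB_signed e\<close> has a slope of sign \<open>e\<close>; the overall sign relating them
    is the product.\<close>
  define \<sigma> where "\<sigma> = \<tau> * e"
  have \<sigma>: "\<sigma> \<in> {1, -1}" using \<tau>(1) e by (auto simp: \<sigma>_def)
  have \<sigma>2: "\<sigma> * (\<sigma> * x) = x" for x using \<sigma> by auto
  have D: "((\<lambda>p. L s p \<psi>) has_real_derivative \<sigma> * (e * sqrt ((\<psi> - p) / p))) (at p)"
    if x: "(s, p, \<psi>) \<in> \<Omega>" for s p \<psi>
  proof -
    have "sqrt ((\<psi> - p) / p) = \<tau> * D\<^sub>p L s p \<psi>"
      using \<tau>(1) \<tau>(2)[OF x] D2[OF x] by (intro real_sqrt_unique) auto
    then have "\<sigma> * (e * sqrt ((\<psi> - p) / p)) = D\<^sub>p L s p \<psi>"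
      using \<tau>(1) e by (auto simp: \<sigma>_def)
    moreover have "(\<lambda>p. L s p \<psi>) field_differentiable at p"
      using th x by (auto simp: nled_theory_def)
    ultimately show ?thesis
      by (simp add: D\<^sub>p_def field_differentiable_derivI)
  qed
  let ?G = "gBB_signed e (\<lambda>_. 0)"
  have "\<forall>\<psi>. \<exists>c. \<forall>x \<in> {(s, p). (s, p, \<psi>) \<in> \<Omega>}. (case x of (s, p) \<Rightarrow> L s p \<psi> - \<sigma> * ?G p \<psi>) = c"
  proof
    fix \<psi>
    have "(\<lambda>(s, p). L s p \<psi> - \<sigma> * ?G p \<psi>) constant_on {(s, p). (s, p, \<psi>) \<in> \<Omega>}"
    proof (rule constant_on_if_partials_vanish)
      show "open {(s, p). (s, p, \<psi>) \<in> \<Omega>}" "connected {(s, p). (s, p, \<psi>) \<in> \<Omega>}"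
        using dom by (simp_all add: nled_domain_def)
      show "L s p \<psi> - \<sigma> * ?G p \<psi> = L s' p \<psi> - \<sigma> * ?G p \<psi>"
        if "(s, p) \<in> {(s, p). (s, p, \<psi>) \<in> \<Omega>}" "(s', p) \<in> {(s, p). (s, p, \<psi>) \<in> \<Omega>}" for s s' p
        using independent_of_sE[OF ind] that by (metis (mono_tags, lifting) case_prodD mem_Collect_eq)
      show "((\<lambda>p. L s p \<psi> - \<sigma> * ?G p \<psi>) has_real_derivative 0) (at p)"
        if "(s, p) \<in> {(s, p). (s, p, \<psi>) \<in> \<Omega>}" for s p
      proof -
        have x: "(s, p, \<psi>) \<in> \<Omega>" using that by simp
        then have "e * \<psi> > 0" using sgn by auto
        from DERIV_diff[OF D[OF x] DERIV_cmult[OF gBB_signed_slope[OF e this real[OF x]], of \<sigma>]]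
        show ?thesis by simp
      qed
    qed
    then show "\<exists>c. \<forall>x \<in> {(s, p). (s, p, \<psi>) \<in> \<Omega>}. (case x of (s, p) \<Rightarrow> L s p \<psi> - \<sigma> * ?G p \<psi>) = c"
      unfolding constant_on_def .
  qed
  then obtain c where "\<forall>\<psi>. \<forall>x \<in> {(s, p). (s, p, \<psi>) \<in> \<Omega>}.
      (case x of (s, p) \<Rightarrow> L s p \<psi> - \<sigma> * ?G p \<psi>) = c \<psi>"
    by (rule choice[THEN exE])
  then have c: "L s p \<psi> = \<sigma> * ?G p \<psi> + c \<psi>" if "(s, p, \<psi>) \<in> \<Omega>" for s p \<psi>
    using that by fastforce
  \<comment> \<open>The overall sign also multiplies \<open>h\<close>, so the slice constants enter
    as \<open>\<sigma> * c \<psi>\<close>, using that \<open>\<sigma>\<close> squares to 1.\<close>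
  have "L s p \<psi> = \<sigma> * gBB_signed e (\<lambda>\<psi>. \<sigma> * c \<psi>) p \<psi>" if "(s, p, \<psi>) \<in> \<Omega>" for s p \<psi>
    unfolding c[OF that] by (simp add: gBB_signed_def distrib_left \<sigma>2)
  with real \<sigma> show ?thesis unfolding in_family_def by blast
qed

lemma in_family_imp_reduced_condition:
  assumes dom: "nled_domain \<Omega>" and e: "e \<in> {1, -1}" and sgn: "\<forall>(s, p, \<psi>) \<in> \<Omega>. e * \<psi> > 0"
    and fam: "in_family (gBB_signed e) \<Omega> L"
  shows "nled_theory \<Omega> L" "independent_of_s \<Omega> L"
    "\<forall>(s, p, \<psi>) \<in> \<Omega>. - p * (D\<^sub>p L s p \<psi>)\<^sup>2 + \<psi> = p"
proof -
  from fam obtain h \<sigma> where real: "\<And>s p \<psi>. (s, p, \<psi>) \<in> \<Omega> \<Longrightarrow> p * (\<psi> - p) > 0"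
    and \<sigma>: "\<sigma> \<in> {1, -1}"
    and L: "\<And>s p \<psi>. (s, p, \<psi>) \<in> \<Omega> \<Longrightarrow> L s p \<psi> = \<sigma> * gBB_signed e h p \<psi>"
    unfolding in_family_def by fast
  show ind: "independent_of_s \<Omega> L"
    unfolding independent_of_s_def by (rule exI[of _ "\<lambda>p \<psi>. \<sigma> * gBB_signed e h p \<psi>"]) (auto simp: L)
  have dL: "((\<lambda>p. L s p \<psi>) has_real_derivative \<sigma> * (e * sqrt ((\<psi> - p) / p))) (at p)"
    if x: "(s, p, \<psi>) \<in> \<Omega>" for s p \<psi>
  proof -
    have "e * \<psi> > 0" using sgn x by auto
    note d = DERIV_cmult[OF gBB_signed_slope[OF e this real[OF x]], of \<sigma> h]
    have "\<forall>\<^sub>F p' in nhds p. L s p' \<psi> = \<sigma> * gBB_signed e h p' \<psi>"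
      using nled_domain_eventually_p[OF dom x] by eventually_elim (rule L)
    from DERIV_cong_ev[OF refl this refl] d show ?thesis by simp
  qed
  then have Dp: "D\<^sub>p L s p \<psi> = \<sigma> * (e * sqrt ((\<psi> - p) / p))" if "(s, p, \<psi>) \<in> \<Omega>" for s p \<psi>
    using that by (simp add: D\<^sub>p_def DERIV_imp_deriv)
  show "\<forall>(s, p, \<psi>) \<in> \<Omega>. - p * (D\<^sub>p L s p \<psi>)\<^sup>2 + \<psi> = p"
  proof safe
    fix s p \<psi> assume x: "(s, p, \<psi>) \<in> \<Omega>"
    have "(\<psi> - p) / p \<ge> 0" "p \<noteq> 0"
      using real[OF x] by (auto simp: zero_le_divide_iff zero_less_mult_iff)
    moreover have "\<sigma>\<^sup>2 = 1" "e\<^sup>2 = 1" using \<sigma> e by auto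
    ultimately show "- p * (D\<^sub>p L s p \<psi>)\<^sup>2 + \<psi> = p"
      by (simp add: Dp[OF x] power_mult_distrib)
  qed
  note Ds = D_s_eq_0_if_independent_of_s[OF dom ind]
  \<comment> \<open>The slope does not involve \<open>h\<close>, so it is jointly continuous even
    though \<open>h\<close> is an arbitrary function.\<close>
  have "continuous_on \<Omega> (\<lambda>(s, p, \<psi>). D\<^sub>p L s p \<psi>) \<longleftrightarrow>
        continuous_on \<Omega> (\<lambda>x. \<sigma> * (e * sqrt ((snd (snd x) - fst (snd x)) / fst (snd x))))"
    by (rule continuous_on_cong) (auto simp: Dp)
  moreover have "continuous_on \<Omega> (\<lambda>x. \<sigma> * (e * sqrt ((snd (snd x) - fst (snd x)) / fst (snd x))))"
    using real by (intro continuous_intros) fastforce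
  moreover have "continuous_on \<Omega> (\<lambda>(s, p, \<psi>). D\<^sub>s L s p \<psi>) \<longleftrightarrow> continuous_on \<Omega> (\<lambda>x. 0 :: real)"
    by (rule continuous_on_cong) (auto simp: Ds)
  moreover have "(\<lambda>s'. L s' p \<psi>) field_differentiable at s"
    "(\<lambda>p'. L s p' \<psi>) field_differentiable at p" if "(s, p, \<psi>) \<in> \<Omega>" for s p \<psi>
    using dL[OF that] Ds(1)[OF that] unfolding field_differentiable_def by blast+
  ultimately show "nled_theory \<Omega> L"
    unfolding nled_theory_def by auto
qed

section \<open>ModMax orbits and fixed points\<close>

text \<open>With \<open>a = arsinh (s / \<bar>p\<bar>)\<close> the root is
  \<open>\<bar>p\<bar> * cosh a\<close>, and the addition formula for \<open>sinh\<close> shifts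
  \<open>a\<close> by \<open>\<gamma>\<close>. The witness is the difference of the two values of
  \<open>a\<close>.\<close>

lemma modmax_orbit:
  fixes s s' p :: real
  assumes "p \<noteq> 0"
  obtains \<gamma> where "s' = cosh \<gamma> * s + sinh \<gamma> * sqrt (s\<^sup>2 + p\<^sup>2)"
proof
  have *: "x = \<bar>p\<bar> * sinh (arsinh (x / \<bar>p\<bar>))" "sqrt (x\<^sup>2 + p\<^sup>2) = \<bar>p\<bar> * cosh (arsinh (x / \<bar>p\<bar>))" for x
  proof -
    show "x = \<bar>p\<bar> * sinh (arsinh (x / \<bar>p\<bar>))" using assms by simp
    have "x\<^sup>2 + p\<^sup>2 = p\<^sup>2 * ((x / \<bar>p\<bar>)\<^sup>2 + 1)" using assms by (simp add: field_simps)
    then show "sqrt (x\<^sup>2 + p\<^sup>2) = \<bar>p\<bar> * cosh (arsinh (x / \<bar>p\<bar>))"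
      by (simp add: real_sqrt_mult cosh_arsinh_real)
  qed
  let ?a = "arsinh (s / \<bar>p\<bar>)" and ?b = "arsinh (s' / \<bar>p\<bar>)"
  have "cosh (?b - ?a) * s + sinh (?b - ?a) * sqrt (s\<^sup>2 + p\<^sup>2)
        = \<bar>p\<bar> * (cosh (?b - ?a) * sinh ?a + sinh (?b - ?a) * cosh ?a)"
    by (simp only: *(2)[of s] *(1)[of s, symmetric] distrib_left mult.left_commute[of "\<bar>p\<bar>"])
  also have "\<dots> = \<bar>p\<bar> * sinh (?b - ?a + ?a)" by (simp only: sinh_add[of "?b - ?a" ?a] add.commute[of "cosh _ * sinh _"])
  also have "\<dots> = s'" using *(1)[of s'] by simp
  finally show "s' = cosh (?b - ?a) * s + sinh (?b - ?a) * sqrt (s\<^sup>2 + p\<^sup>2)" by simp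
qed

text \<open>The map moves only \<open>s\<close>, so independence of \<open>s\<close> gives
  invariance. Conversely, transitivity in \<open>s\<close> needs \<open>p \<noteq> 0\<close>, and
  duality invariance is what excludes \<open>p = 0\<close>, where the orbits are the two half-lines
  and the origin.\<close>

lemma modmax_fixed_point_iff:
  assumes dom: "nled_domain \<Omega>" "modmax_domain \<Omega>" and inv: "duality_invariant \<Omega> L"
  shows "modmax_fixed_point \<Omega> L \<longleftrightarrow> independent_of_s \<Omega> L"
proof
  assume "independent_of_s \<Omega> L"
  then show "modmax_fixed_point \<Omega> L"
  proof (rule independent_of_sE)
    fix l assume l: "\<And>s p \<psi>. (s, p, \<psi>) \<in> \<Omega> \<Longrightarrow> L s p \<psi> = l p \<psi>"
    have "(cosh \<gamma> * s + sinh \<gamma> * sqrt (s\<^sup>2 + p\<^sup>2), p, \<psi>) \<in> \<Omega>" if "(s, p, \<psi>) \<in> \<Omega>" for \<gamma> s p \<psi>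
      using dom(2) that by (auto simp: modmax_domain_def)
    then show ?thesis by (auto simp: modmax_fixed_point_def modmax_def l)
  qed
next
  assume fix': "modmax_fixed_point \<Omega> L"
  \<comment> \<open>On \<open>p = 0\<close> the ModMax map rescales \<open>s\<close>, so \<open>\<partial>\<^sub>s L = 0\<close> and duality invariance forces \<open>\<psi> = 0\<close>.\<close>
  have p: "p \<noteq> 0" if x: "(s, p, \<psi>) \<in> \<Omega>" for s p \<psi>
  proof
    assume [simp]: "p = 0"
    have "- 2 * s * D\<^sub>s L s 0 \<psi> * D\<^sub>p L s 0 \<psi> + \<psi> = 0"
      using inv x by (fastforce simp: duality_invariant_def)
    moreover have "\<psi> \<noteq> 0" using dom x by (auto simp: nled_domain_def)
    ultimately have s: "s \<noteq> 0" and Ds: "D\<^sub>s L s 0 \<psi> \<noteq> 0" by auto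
    have "\<forall>\<^sub>F s' in nhds s. s' / s > 0"
      by (rule order_tendstoD(1)[of _ 1]) (use s in \<open>auto intro!: tendsto_eq_intros filterlim_ident\<close>)
    then have "\<forall>\<^sub>F s' in nhds s. L s' 0 \<psi> = L s 0 \<psi>"
    proof eventually_elim
      case (elim s')
      \<comment> \<open>At \<open>p = 0\<close> the scale factor is
        \<open>exp (sgn s * \<gamma>)\<close>, so this parameter carries \<open>s\<close> to
        \<open>s'\<close>.\<close>
      define \<gamma> where "\<gamma> = sgn s * ln (s' / s)"
      have "cosh \<gamma> * s + sinh \<gamma> * sqrt (s\<^sup>2 + 0\<^sup>2) = s * exp (sgn s * \<gamma>)"
        using s by (cases "s > 0") (auto simp: cosh_def sinh_def field_simps)
      also have "\<dots> = s'"
        using s elim by (cases "s > 0") (auto simp: \<gamma>_def)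
      finally have "modmax \<gamma> L s 0 \<psi> = L s' 0 \<psi>" by (simp add: modmax_def)
      moreover have "modmax \<gamma> L s 0 \<psi> = L s 0 \<psi>"
        using fix' x by (auto simp: modmax_fixed_point_def)
      ultimately show ?case by simp
    qed
    then have "D\<^sub>s L s 0 \<psi> = deriv (\<lambda>_. L s 0 \<psi>) s"
      unfolding D\<^sub>s_def by (rule deriv_cong_ev) simp
    with Ds show False by simp
  qed
  have "L s p \<psi> = L s' p \<psi>" if x: "(s, p, \<psi>) \<in> \<Omega>" "(s', p, \<psi>) \<in> \<Omega>" for s s' p \<psi>
  proof -
    obtain \<gamma> where "s' = cosh \<gamma> * s + sinh \<gamma> * sqrt (s\<^sup>2 + p\<^sup>2)" by (rule modmax_orbit[OF p[OF x(1)]])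
    then have "modmax \<gamma> L s p \<psi> = L s' p \<psi>" by (simp add: modmax_def)
    moreover have "modmax \<gamma> L s p \<psi> = L s p \<psi>"
      using fix' x(1) by (auto simp: modmax_fixed_point_def)
    ultimately show ?thesis by simp
  qed
  \<comment> \<open>A representative \<open>s\<close> is chosen for each pair of \<open>p\<close>
    and \<psi>, which turns \<open>L\<close> into a function of that pair.\<close>
  then have "L s p \<psi> = L (SOME s. (s, p, \<psi>) \<in> \<Omega>) p \<psi>" if "(s, p, \<psi>) \<in> \<Omega>" for s p \<psi>
    using that someI[of "\<lambda>s. (s, p, \<psi>) \<in> \<Omega>"] by blast
  then show "independent_of_s \<Omega> L"
    unfolding independent_of_s_def by (intro exI[of _ "\<lambda>p \<psi>. L (SOME s. (s, p, \<psi>) \<in> \<Omega>) p \<psi>"]) auto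
qed

text \<open>Independence of \<open>s\<close> makes \<open>D\<^sub>s L\<close> vanish, which
  identifies duality invariance with the reduced condition; on ModMax-stable domains it may be
  traded for being a fixed point. The parameter \<open>e\<close> treats both signs of \<psi>
  together.\<close>

lemma general_solutions:
  assumes dom: "nled_domain \<Omega>" and e: "e \<in> {1, -1}" and sgn: "\<forall>(s, p, \<psi>) \<in> \<Omega>. e * \<psi> > 0"
  shows reduced_condition_iff_in_family:
      "nled_theory \<Omega> L \<and> independent_of_s \<Omega> L \<and>
         (\<forall>(s, p, \<psi>) \<in> \<Omega>. - p * (D\<^sub>p L s p \<psi>)\<^sup>2 + \<psi> = p) \<longleftrightarrow> in_family (gBB_signed e) \<Omega> L"
    and duality_invariant_iff_in_family:
      "nled_theory \<Omega> L \<and> independent_of_s \<Omega> L \<and> duality_invariant \<Omega> L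
         \<longleftrightarrow> in_family (gBB_signed e) \<Omega> L"
    and modmax_fixed_point_iff_in_family:
      "modmax_domain \<Omega> \<Longrightarrow> nled_theory \<Omega> L \<and> duality_invariant \<Omega> L \<and> modmax_fixed_point \<Omega> L
         \<longleftrightarrow> in_family (gBB_signed e) \<Omega> L"
proof -
  note sol = reduced_condition_imp_in_family[OF dom e sgn] in_family_imp_reduced_condition[OF dom e sgn]
  show red: "nled_theory \<Omega> L \<and> independent_of_s \<Omega> L \<and>
         (\<forall>(s, p, \<psi>) \<in> \<Omega>. - p * (D\<^sub>p L s p \<psi>)\<^sup>2 + \<psi> = p) \<longleftrightarrow> in_family (gBB_signed e) \<Omega> L" for L
    using sol by blast
  show dual: "nled_theory \<Omega> L \<and> independent_of_s \<Omega> L \<and> duality_invariant \<Omega> L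
         \<longleftrightarrow> in_family (gBB_signed e) \<Omega> L"
    using red[of L] duality_invariant_iff_reduced[OF D_s_eq_0_if_independent_of_s(2)[OF dom]] by blast
  show "nled_theory \<Omega> L \<and> duality_invariant \<Omega> L \<and> modmax_fixed_point \<Omega> L
         \<longleftrightarrow> in_family (gBB_signed e) \<Omega> L" if "modmax_domain \<Omega>"
    using dual modmax_fixed_point_iff[OF dom that] by blast
qed

section \<open>Complex branches and the reality region\<close>

definition gBB_signed_complex :: "real \<Rightarrow> (real \<Rightarrow> real) \<Rightarrow> real \<Rightarrow> real \<Rightarrow> complex" where
  "gBB_signed_complex e h p \<psi> =
     csqrt (of_real ((\<psi> - p) * p)) +
     of_real (e * \<psi>) * Arctan (csqrt (of_real (p / (\<psi> - p)))) + of_real (h \<psi>)"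

lemma gBB_complex_eq_signed: "gBB_complex = gBB_signed_complex 1"
  and gBB_flip_complex_eq_signed: "gBB_flip_complex = gBB_signed_complex (- 1)"
  by (simp_all add: fun_eq_iff gBB_complex_def gBB_flip_complex_def gBB_signed_complex_def)

text \<open>The logarithm defining \<open>Arctan\<close> gets the real argument
  \<open>(1 + t) / (1 - t)\<close>. This is negative exactly for \<open>t > 1\<close>, where the
  principal branch adds \<open>\<i> * pi\<close> and so shifts the result by
  \<open>- pi / 2\<close>.\<close>

lemma Arctan_ii_times_of_real:
  assumes "t \<ge> 0" "t \<noteq> 1"
  shows "Arctan (\<i> * of_real t) =
         \<i> * of_real (ln \<bar>(1 + t) / (1 - t)\<bar> / 2) - of_real (if t > 1 then pi / 2 else 0)"
proof -
  have "(1 - \<i> * (\<i> * of_real t)) / (1 + \<i> * (\<i> * of_real t)) = complex_of_real ((1 + t) / (1 - t))"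
    by (simp add: mult.assoc[symmetric])
  moreover have "(1 + t) / (1 - t) \<noteq> 0" "(1 + t) / (1 - t) < 0 \<longleftrightarrow> t > 1"
    using assms by (auto simp: divide_less_0_iff)
  ultimately show ?thesis
    unfolding Arctan_def by (simp add: Ln_of_real' del: of_real_divide) (simp add: algebra_simps)
qed

lemma gBB_signed_complex_eq_of_real:
  assumes "p * (\<psi> - p) \<ge> 0"
  shows "gBB_signed_complex e h p \<psi> =
    of_real (sqrt ((\<psi> - p) * p) + e * \<psi> * arctan (sqrt (p / (\<psi> - p))) + h \<psi>)"
proof -
  \<comment> \<open>The boundary \<open>p = \<psi>\<close> is included, since there the quotient is
    a division by zero with value 0.\<close>
  have "(\<psi> - p) * p \<ge> 0" "p / (\<psi> - p) \<ge> 0"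
    using assms by (auto simp: zero_le_mult_iff zero_le_divide_iff)
  then show ?thesis
    unfolding gBB_signed_complex_def by (simp add: of_real_sqrt[symmetric] Arctan_of_real
        del: of_real_mult of_real_divide of_real_diff csqrt_of_real_nonneg) simp
qed

text \<open>Outside the reality region both roots are purely imaginary and are expressed by one
  positive \<open>t\<close>. The last identity shows that the singular value \<open>t = 1\<close>
  occurs only for \<open>\<psi> = 0\<close>.\<close>

lemma gBB_signed_complex_outside:
  assumes neg: "p * (\<psi> - p) < 0"
  defines "t \<equiv> sqrt (p / (p - \<psi>))"
  shows "t > 0"
    and "csqrt (of_real ((\<psi> - p) * p)) = \<i> * of_real (t * \<bar>p - \<psi>\<bar>)"
    and "csqrt (of_real (p / (\<psi> - p))) = \<i> * of_real t"
    and "1 - t\<^sup>2 = - \<psi> / (p - \<psi>)"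
proof -
  have pos: "p / (p - \<psi>) > 0" "p - \<psi> \<noteq> 0"
    using neg by (auto simp: mult_less_0_iff zero_less_divide_iff)
  show "t > 0" using pos by (simp add: t_def)
  have t2: "t\<^sup>2 = p / (p - \<psi>)" using pos by (simp add: t_def)
  then show "1 - t\<^sup>2 = - \<psi> / (p - \<psi>)" using pos by (simp add: field_simps)
  have "p / (\<psi> - p) = - (p / (p - \<psi>))" using pos(2) by (simp add: field_simps)
  then show "csqrt (of_real (p / (\<psi> - p))) = \<i> * of_real t"
    using pos by (simp add: t_def abs_of_pos del: of_real_divide abs_divide)
  have "p * (p - \<psi>) = (t * \<bar>p - \<psi>\<bar>)\<^sup>2"
    using pos(2) unfolding power_mult_distrib t2 by (simp add: power2_eq_square)
  then have "sqrt (p * (p - \<psi>)) = t * \<bar>p - \<psi>\<bar>"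
    using \<open>t > 0\<close> by (intro real_sqrt_unique) auto
  moreover have "\<bar>(\<psi> - p) * p\<bar> = p * (p - \<psi>)" "(\<psi> - p) * p < 0"
    using neg by (simp_all add: algebra_simps)
  ultimately show "csqrt (of_real ((\<psi> - p) * p)) = \<i> * of_real (t * \<bar>p - \<psi>\<bar>)"
    by (simp del: of_real_mult)
qed

text \<open>The imaginary part is
  \<open>t * \<bar>p - \<psi>\<bar> + e * \<psi> * (ln x / 2)\<close>. Since
  \<open>\<bar>\<psi>\<bar> * (x - 1 / x) = 4 * (t * \<bar>p - \<psi>\<bar>)\<close>, the logarithm
  bound makes the second term strictly smaller in modulus than the first, whatever the signs of
  \<open>e\<close> and \<psi>.\<close>

lemma gBB_signed_complex_notin_Reals:
  assumes neg: "p * (\<psi> - p) < 0" and e: "e \<in> {1, -1}"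
  shows "gBB_signed_complex e h p \<psi> \<notin> \<real>"
proof -
  define t where "t = sqrt (p / (p - \<psi>))"
  note t = gBB_signed_complex_outside[OF neg, folded t_def]
  have p\<psi>: "p - \<psi> \<noteq> 0" using neg by auto
  have "Im (gBB_signed_complex e h p \<psi>) \<noteq> 0"
  proof (cases "\<psi> = 0")
    case True
    then show ?thesis using t(1) p\<psi> by (simp add: gBB_signed_complex_def t(2))
  next
    case False
    have "t \<noteq> 1" using t(4) False p\<psi> by auto
    define x where "x = \<bar>(1 + t) / (1 - t)\<bar>"
    have "x > 1" using t(1) \<open>t \<noteq> 1\<close> by (simp add: x_def divide_simps)
    have "x - 1 / x = 4 * t / \<bar>1 - t\<^sup>2\<bar>"
    proof -
      have "x - 1 / x = ((1 + t)\<^sup>2 - (1 - t)\<^sup>2) / (\<bar>1 - t\<bar> * \<bar>1 + t\<bar>)"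
        using t(1) \<open>t \<noteq> 1\<close> by (simp add: x_def divide_simps power2_eq_square)
      also have "(1 + t)\<^sup>2 - (1 - t)\<^sup>2 = 4 * t" by (simp add: power2_eq_square algebra_simps)
      also have "\<bar>1 - t\<bar> * \<bar>1 + t\<bar> = \<bar>1 - t\<^sup>2\<bar>"
        by (simp add: abs_mult[symmetric] power2_eq_square algebra_simps)
      finally show ?thesis .
    qed
    also have "\<dots> = 4 * (t * \<bar>p - \<psi>\<bar>) / \<bar>\<psi>\<bar>" unfolding t(4) by (simp add: abs_divide)
    finally have "\<bar>\<psi>\<bar> * (x - 1 / x) = 4 * (t * \<bar>p - \<psi>\<bar>)" using False by simp
    moreover have "\<bar>\<psi>\<bar> * ln x < \<bar>\<psi>\<bar> * ((x - 1 / x) / 2)"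
      using ln_less_half_diff_inverse[OF \<open>x > 1\<close>] False by simp
    ultimately have less: "\<bar>\<psi>\<bar> * ln x < 2 * (t * \<bar>p - \<psi>\<bar>)" by simp
    have "ln x > 0" using \<open>x > 1\<close> by simp
    have "\<bar>e * \<psi> * (ln x / 2)\<bar> < t * \<bar>p - \<psi>\<bar>"
      using less e \<open>ln x > 0\<close> by (auto simp: abs_mult)
    moreover have "Im (gBB_signed_complex e h p \<psi>) = t * \<bar>p - \<psi>\<bar> + e * \<psi> * (ln x / 2)"
      unfolding gBB_signed_complex_def t(2,3) x_def
      using Arctan_ii_times_of_real[of t] t(1) \<open>t \<noteq> 1\<close> by simp
    ultimately show ?thesis by linarith
  qed
  then show ?thesis by (simp add: complex_is_Real_iff)
qed

lemma gBB_signed_complex_in_Reals_iff: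
  assumes "e \<in> {1, -1}"
  shows "gBB_signed_complex e h p \<psi> \<in> \<real> \<longleftrightarrow> p * (\<psi> - p) \<ge> 0"
  using gBB_signed_complex_notin_Reals[OF _ assms] gBB_signed_complex_eq_of_real
  by (metis Reals_of_real not_le)

section \<open>The limit of vanishing \<psi>, and the absence of a Maxwell limit\<close>

lemma tendsto_mult_ln_abs_0: "((\<lambda>x::real. x * ln \<bar>x\<bar>) \<longlongrightarrow> 0) (at 0)"
proof -
  have "((\<lambda>x::real. x * ln \<bar>x\<bar>) \<longlongrightarrow> 0) (at_right 0)" by real_asymp
  moreover have "((\<lambda>x::real. x * ln \<bar>x\<bar>) \<longlongrightarrow> 0) (at_left 0)" by real_asymp
  ultimately show ?thesis by (simp add: filterlim_at_split)
qed

text \<open>As \<psi> tends to 0, \<open>t\<close> tends to the singular value 1, but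
  \<open>Arctan\<close> diverges only logarithmically. The bound \<open>g\<close> isolates the
  divergence in \<open>\<psi> * ln \<bar>\<psi>\<bar>\<close>, which tends to 0.\<close>

lemma tendsto_mult_Arctan_0:
  assumes "p \<noteq> 0"
  shows "((\<lambda>\<psi>. of_real (e * \<psi>) * Arctan (csqrt (of_real (p / (\<psi> - p))))) \<longlongrightarrow> 0) (at 0)"
proof -
  define t where "t = (\<lambda>\<psi>. sqrt (p / (p - \<psi>)))"
  define g where "g = (\<lambda>\<psi>. \<bar>e\<bar> * (\<bar>2 * (\<psi> * ln (1 + t \<psi>)) - \<psi> * ln \<bar>\<psi>\<bar> + \<psi> * ln \<bar>p - \<psi>\<bar>\<bar> / 2 + \<bar>\<psi>\<bar> * (pi / 2)))"
  have "(t \<longlongrightarrow> sqrt (p / (p - 0))) (at 0)"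
    unfolding t_def using assms by (intro tendsto_intros) simp
  then have t1: "(t \<longlongrightarrow> 1) (at 0)" using assms by simp
  have "(g \<longlongrightarrow> \<bar>e\<bar> * (\<bar>2 * (0 * ln (1 + 1)) - 0 + 0 * ln \<bar>p - 0\<bar>\<bar> / 2 + \<bar>0\<bar> * (pi / 2))) (at 0)"
    unfolding g_def using assms by (intro tendsto_intros t1 tendsto_mult_ln_abs_0) auto
  then have g0: "(g \<longlongrightarrow> 0) (at 0)" by simp
  have "((\<lambda>\<psi>. p * (\<psi> - p)) \<longlongrightarrow> p * (0 - p)) (at 0)" by (intro tendsto_intros)
  moreover have "p * (0 - p) < 0" using assms by (simp flip: power2_eq_square)
  ultimately have "\<forall>\<^sub>F \<psi> in at 0. p * (\<psi> - p) < 0" by (rule order_tendstoD(2))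
  moreover have "\<forall>\<^sub>F \<psi> in at (0::real). \<psi> \<noteq> 0" by (simp add: eventually_at_filter)
  ultimately have "\<forall>\<^sub>F \<psi> in at 0.
      norm (of_real (e * \<psi>) * Arctan (csqrt (of_real (p / (\<psi> - p))))) \<le> g \<psi>"
  proof eventually_elim
    case (elim \<psi>)
    note t = gBB_signed_complex_outside[OF elim(1), folded t_def[THEN fun_cong, simplified]]
    have p\<psi>: "p - \<psi> \<noteq> 0" using elim by auto
    have "t \<psi> \<noteq> 1" using t(4) elim p\<psi> by auto
    have "1 + t \<psi> > 0" using t(1) by simp
    have "\<bar>(1 + t \<psi>) / (1 - t \<psi>)\<bar> = (1 + t \<psi>) * (1 + t \<psi>) / \<bar>1 - (t \<psi>)\<^sup>2\<bar>"
    proof -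
      have "1 - (t \<psi>)\<^sup>2 = (1 - t \<psi>) * (1 + t \<psi>)"
        by (simp add: power2_eq_square algebra_simps)
      then have "\<bar>1 - (t \<psi>)\<^sup>2\<bar> = \<bar>1 - t \<psi>\<bar> * (1 + t \<psi>)"
        using \<open>1 + t \<psi> > 0\<close> by (simp add: abs_mult)
      then show ?thesis using \<open>1 + t \<psi> > 0\<close> by simp
    qed
    also have "\<dots> = (1 + t \<psi>) * (1 + t \<psi>) * \<bar>p - \<psi>\<bar> / \<bar>\<psi>\<bar>"
      unfolding t(4) by (simp add: abs_divide)
    finally have ln: "ln \<bar>(1 + t \<psi>) / (1 - t \<psi>)\<bar> = 2 * ln (1 + t \<psi>) - ln \<bar>\<psi>\<bar> + ln \<bar>p - \<psi>\<bar>"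
      using \<open>1 + t \<psi> > 0\<close> p\<psi> elim by (simp add: ln_mult ln_div)
    have "norm (Arctan (\<i> * of_real (t \<psi>))) \<le> \<bar>ln \<bar>(1 + t \<psi>) / (1 - t \<psi>)\<bar> / 2\<bar> + pi / 2"
      unfolding Arctan_ii_times_of_real[OF less_imp_le[OF t(1)] \<open>t \<psi> \<noteq> 1\<close>]
      by (rule order_trans[OF norm_triangle_ineq4]) (auto simp: norm_mult simp del: of_real_divide)
    then have "norm (of_real (e * \<psi>) * Arctan (\<i> * of_real (t \<psi>)))
        \<le> \<bar>e * \<psi>\<bar> * (\<bar>ln \<bar>(1 + t \<psi>) / (1 - t \<psi>)\<bar> / 2\<bar> + pi / 2)"
      unfolding norm_mult norm_of_real by (intro mult_left_mono) auto
    also have "\<dots> = g \<psi>"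
      unfolding ln g_def by (simp add: abs_mult algebra_simps flip: abs_mult)
    finally show ?case unfolding t(3) .
  qed
  then show ?thesis by (rule Lim_null_comparison[OF _ g0])
qed

text \<open>For \<open>p \<noteq> 0\<close> the radicand tends to \<open>- p\<^sup>2 < 0\<close>, so
  its principal root tends to \<open>\<i> * \<bar>p\<bar>\<close>, and the arctangent term vanishes
  in the limit. For \<open>p = 0\<close> both terms are identically zero.\<close>

lemma gBB_signed_complex_tendsto_bialynicki_birula:
  assumes "(h \<longlongrightarrow> c) (at 0)"
  shows "((\<lambda>\<psi>. gBB_signed_complex e h p \<psi>) \<longlongrightarrow> bialynicki_birula p + of_real c) (at 0)"
proof (cases "p = 0")
  case True
  have "Arctan 0 = 0" using Arctan_of_real[of 0] by simp
  with True show ?thesis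
    using tendsto_of_real[OF assms] by (simp add: gBB_signed_complex_def bialynicki_birula_def)
next
  case False
  have "((\<lambda>\<psi>. \<i> * of_real (sqrt \<bar>(\<psi> - p) * p\<bar>)) \<longlongrightarrow> \<i> * of_real (sqrt \<bar>(0 - p) * p\<bar>)) (at 0)"
    by (intro tendsto_intros)
  moreover have "sqrt \<bar>(0 - p) * p\<bar> = \<bar>p\<bar>" by (simp add: abs_mult)
  moreover
  have "((\<lambda>\<psi>. (\<psi> - p) * p) \<longlongrightarrow> (0 - p) * p) (at 0)" by (intro tendsto_intros)
  then have "\<forall>\<^sub>F \<psi> in at 0. (\<psi> - p) * p < 0"
    by (rule order_tendstoD(2)) (use False in \<open>simp flip: power2_eq_square\<close>)
  then have "\<forall>\<^sub>F \<psi> in at 0. \<i> * of_real (sqrt \<bar>(\<psi> - p) * p\<bar>) = csqrt (of_real ((\<psi> - p) * p))"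
    by eventually_elim (simp del: of_real_mult)
  ultimately have "((\<lambda>\<psi>. csqrt (of_real ((\<psi> - p) * p))) \<longlongrightarrow> bialynicki_birula p) (at 0)"
    unfolding bialynicki_birula_def by (simp only: tendsto_cong)
  from tendsto_add[OF tendsto_add[OF this tendsto_mult_Arctan_0[OF False]] tendsto_of_real[OF assms]]
  show ?thesis by (simp add: gBB_signed_complex_def)
qed

text \<open>An open region contains two points with equal \<open>p\<close> and different
  \<open>s\<close>; uniqueness of limits would equate these two values of \<open>s\<close>. As
  \<open>l\<close> is arbitrary, rescaled Lagrangians with varying \<psi> and \<open>h\<close> are
  covered.\<close>

lemma no_maxwell_limit_if_independent_of_s:
  assumes "F \<noteq> bot"
  shows "\<not> maxwell_limit F (\<lambda>i s p. l i p)"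
proof
  assume "maxwell_limit F (\<lambda>i s p. l i p)"
  then obtain U where U: "open U" "U \<noteq> {}"
    and lim: "\<And>s p. (s, p) \<in> U \<Longrightarrow> ((\<lambda>i. l i p) \<longlongrightarrow> of_real s) F"
    unfolding maxwell_limit_def maxwell_def by blast
  obtain s p where sp: "(s, p) \<in> U" using U(2) by auto
  have "open ((\<lambda>s'. (s', p)) -` U)" by (rule open_vimage[OF U(1)]) (intro continuous_intros)
  then obtain d where d: "d > 0" "ball s d \<subseteq> (\<lambda>s'. (s', p)) -` U" using sp by (meson openE vimageI)
  then have "(s + d / 2, p) \<in> U" by (auto simp: dist_norm subset_iff)
  from tendsto_unique[OF assms lim[OF this] lim[OF sp]] d(1) show False
    by (simp only: of_real_eq_iff)
qed

lemma topological_term_bialynicki_birula: "topological_term bialynicki_birula"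
  unfolding topological_term_def
proof (intro allI impI)
  fix p\<^sub>0 :: real assume "p\<^sub>0 \<noteq> 0"
  have "\<forall>\<^sub>F p in nhds p\<^sub>0. p / p\<^sub>0 > 0"
    by (rule order_tendstoD(1)[of _ 1]) (use \<open>p\<^sub>0 \<noteq> 0\<close> in \<open>auto intro!: tendsto_eq_intros filterlim_ident\<close>)
  then have "\<forall>\<^sub>F p in nhds p\<^sub>0. bialynicki_birula p = \<i> * of_real (sgn p\<^sub>0) * of_real p"
  proof eventually_elim
    case (elim p)
    then have "\<bar>p\<bar> = sgn p\<^sub>0 * p" by (auto simp: sgn_if zero_less_divide_iff)
    then show ?case by (simp add: bialynicki_birula_def)
  qed
  then show "\<exists>\<theta>. \<forall>\<^sub>F p in nhds p\<^sub>0. bialynicki_birula p = \<theta> * of_real p" by blast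
qed

section \<open>Weak-field expansions\<close>

text \<open>The root scales with \<open>\<bar>\<psi>\<bar>\<close> and the arctangent term with
  \<psi>. So the two terms add for \<open>\<psi> > 0\<close>, while for \<open>\<psi> < 0\<close>
  their leading \<open>sqrt y\<close> contributions cancel and order \<open>y powr (3/2)\<close>
  remains.\<close>

lemma gBB_0_scaling:
  assumes "\<psi> \<noteq> 0"
  shows "gBB (\<lambda>_. 0) (y * \<psi>) \<psi> = \<bar>\<psi>\<bar> * sqrt (y * (1 - y)) + \<psi> * arctan (sqrt (y / (1 - y)))"
proof -
  have "(\<psi> - y * \<psi>) * (y * \<psi>) = \<psi>\<^sup>2 * (y * (1 - y))" by (simp add: algebra_simps power2_eq_square)
  then have "sqrt ((\<psi> - y * \<psi>) * (y * \<psi>)) = \<bar>\<psi>\<bar> * sqrt (y * (1 - y))"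
    by (simp only: real_sqrt_mult[of "\<psi>\<^sup>2"] real_sqrt_abs)
  moreover have "(y * \<psi>) / (\<psi> - y * \<psi>) = y / (1 - y)"
  proof -
    have "(y * \<psi>) / (\<psi> - y * \<psi>) = (y * \<psi>) / ((1 - y) * \<psi>)" by (simp add: left_diff_distrib)
    then show ?thesis using assms by simp
  qed
  ultimately show ?thesis by (simp add: gBB_def)
qed

lemma gBB_weak_field_pos:
  "\<exists>r \<in> O[at_right 0](\<lambda>y. y ^ 3). \<forall>p \<psi>. \<forall>y\<in>{0<..<1}. y = p / \<psi> \<and> \<psi> > 0 \<longrightarrow>
     gBB (\<lambda>_. 0) p \<psi> = 2 * \<psi> * sqrt y * (1 - y / 6 - y\<^sup>2 / 40 + r y)"
proof
  \<comment> \<open>The remainder is the exact ratio minus the truncated series, so one function of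
    \<open>y\<close> serves all \<open>p\<close> and \<psi>, and only its order is left to
    estimate.\<close>
  let ?r = "\<lambda>y::real. (sqrt (y * (1 - y)) + arctan (sqrt (y / (1 - y)))) / (2 * sqrt y) - (1 - y / 6 - y\<^sup>2 / 40)"
  show "?r \<in> O[at_right 0](\<lambda>y. y ^ 3)" by real_asymp
  show "\<forall>p \<psi>. \<forall>y\<in>{0<..<1}. y = p / \<psi> \<and> \<psi> > 0 \<longrightarrow>
     gBB (\<lambda>_. 0) p \<psi> = 2 * \<psi> * sqrt y * (1 - y / 6 - y\<^sup>2 / 40 + ?r y)"
  proof (intro allI ballI impI)
    fix p \<psi> y :: real assume y: "y \<in> {0<..<1}" and "y = p / \<psi> \<and> \<psi> > 0"
    then have "p = y * \<psi>" "\<psi> > 0" by auto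
    then show "gBB (\<lambda>_. 0) p \<psi> = 2 * \<psi> * sqrt y * (1 - y / 6 - y\<^sup>2 / 40 + ?r y)"
      using y by (simp add: gBB_0_scaling) (simp add: distrib_left)
  qed
qed

lemma gBB_weak_field_neg:
  "\<exists>r \<in> O[at_right 0](\<lambda>y. y ^ 3). \<forall>p \<psi>. \<forall>y\<in>{0<..<1}. y = p / \<psi> \<and> \<psi> < 0 \<longrightarrow>
     gBB (\<lambda>_. 0) p \<psi> = 2 * \<psi> * y powr (3/2) / 3 * (1 + 3 * y / 10 + 9 * y\<^sup>2 / 56 + r y)"
proof
  let ?r = "\<lambda>y::real. 3 * (arctan (sqrt (y / (1 - y))) - sqrt (y * (1 - y))) / (2 * y powr (3/2))
    - (1 + 3 * y / 10 + 9 * y\<^sup>2 / 56)"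
  show "?r \<in> O[at_right 0](\<lambda>y. y ^ 3)" by real_asymp
  show "\<forall>p \<psi>. \<forall>y\<in>{0<..<1}. y = p / \<psi> \<and> \<psi> < 0 \<longrightarrow>
     gBB (\<lambda>_. 0) p \<psi> = 2 * \<psi> * y powr (3/2) / 3 * (1 + 3 * y / 10 + 9 * y\<^sup>2 / 56 + ?r y)"
  proof (intro allI ballI impI)
    fix p \<psi> y :: real assume y: "y \<in> {0<..<1}" and "y = p / \<psi> \<and> \<psi> < 0"
    then have "p = y * \<psi>" "\<psi> < 0" by auto
    then show "gBB (\<lambda>_. 0) p \<psi> = 2 * \<psi> * y powr (3/2) / 3 * (1 + 3 * y / 10 + 9 * y\<^sup>2 / 56 + ?r y)"
      using y by (simp add: gBB_0_scaling) (simp add: right_diff_distrib)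
  qed
qed

theorem mainTheorem3:
  shows
    "(\<forall>\<Omega>. nled_domain \<Omega> \<longrightarrow>
        \<comment> \<open>no theory independent of p\<close>
        \<not> (\<exists>L. nled_theory \<Omega> L \<and> independent_of_p \<Omega> L \<and> duality_invariant \<Omega> L) \<and>
        \<comment> \<open>reduction for theories independent of s\<close>
        (\<forall>L. nled_theory \<Omega> L \<and> independent_of_s \<Omega> L \<longrightarrow>
           (duality_invariant \<Omega> L \<longleftrightarrow> (\<forall>(s, p, \<psi>) \<in> \<Omega>. - p * (D\<^sub>p L s p \<psi>)\<^sup>2 + \<psi> = p))) \<and>
        \<comment> \<open>general solution of the reduced condition\<close>
        ((\<forall>(s, p, \<psi>) \<in> \<Omega>. \<psi> > 0) \<longrightarrow>
           (\<forall>L. nled_theory \<Omega> L \<and> independent_of_s \<Omega> L \<and>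
                  (\<forall>(s, p, \<psi>) \<in> \<Omega>. - p * (D\<^sub>p L s p \<psi>)\<^sup>2 + \<psi> = p)
                \<longleftrightarrow> in_family gBB \<Omega> L)) \<and>
        ((\<forall>(s, p, \<psi>) \<in> \<Omega>. \<psi> < 0) \<longrightarrow>
           (\<forall>L. nled_theory \<Omega> L \<and> independent_of_s \<Omega> L \<and>
                  (\<forall>(s, p, \<psi>) \<in> \<Omega>. - p * (D\<^sub>p L s p \<psi>)\<^sup>2 + \<psi> = p)
                \<longleftrightarrow> in_family gBB_flip \<Omega> L)) \<and>
        \<comment> \<open>general duality-invariant theory independent of s\<close>
        ((\<forall>(s, p, \<psi>) \<in> \<Omega>. \<psi> > 0) \<longrightarrow>
           (\<forall>L. nled_theory \<Omega> L \<and> independent_of_s \<Omega> L \<and> duality_invariant \<Omega> L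
                \<longleftrightarrow> in_family gBB \<Omega> L)) \<and>
        ((\<forall>(s, p, \<psi>) \<in> \<Omega>. \<psi> < 0) \<longrightarrow>
           (\<forall>L. nled_theory \<Omega> L \<and> independent_of_s \<Omega> L \<and> duality_invariant \<Omega> L
                \<longleftrightarrow> in_family gBB_flip \<Omega> L)) \<and>
        \<comment> \<open>general duality-invariant fixed point of the ModMax map\<close>
        (modmax_domain \<Omega> \<and> (\<forall>(s, p, \<psi>) \<in> \<Omega>. \<psi> > 0) \<longrightarrow>
           (\<forall>L. nled_theory \<Omega> L \<and> duality_invariant \<Omega> L \<and> modmax_fixed_point \<Omega> L
                \<longleftrightarrow> in_family gBB \<Omega> L)) \<and>
        (modmax_domain \<Omega> \<and> (\<forall>(s, p, \<psi>) \<in> \<Omega>. \<psi> < 0) \<longrightarrow>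
           (\<forall>L. nled_theory \<Omega> L \<and> duality_invariant \<Omega> L \<and> modmax_fixed_point \<Omega> L
                \<longleftrightarrow> in_family gBB_flip \<Omega> L))) \<and>
     \<comment> \<open>reality\<close>
     (\<forall>h p \<psi>. (gBB_complex h p \<psi> \<in> \<real> \<longleftrightarrow> p * (\<psi> - p) \<ge> 0) \<and>
              (gBB_flip_complex h p \<psi> \<in> \<real> \<longleftrightarrow> p * (\<psi> - p) \<ge> 0) \<and>
              (p * (\<psi> - p) \<ge> 0 \<longrightarrow>
                 gBB_complex h p \<psi> = of_real (gBB h p \<psi>) \<and>
                 gBB_flip_complex h p \<psi> = of_real (gBB_flip h p \<psi>))) \<and>
     \<comment> \<open>homogeneity\<close>
     (\<forall>h. linear h \<longrightarrow>
        (\<forall>L\<in>{(\<lambda>s. gBB h), (\<lambda>s. gBB_flip h)}. \<forall>s p \<psi>. p * (\<psi> - p) > 0 \<longrightarrow>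
           (\<lambda>s'. L s' p \<psi>) field_differentiable at s \<and>
           (\<lambda>p'. L s p' \<psi>) field_differentiable at p \<and>
           (\<lambda>\<psi>'. L s p \<psi>') field_differentiable at \<psi> \<and>
           s * D\<^sub>s L s p \<psi> + p * D\<^sub>p L s p \<psi> + \<psi> * D\<^sub>\<psi> L s p \<psi> = L s p \<psi>)) \<and>
     \<comment> \<open>the limit to Bialynicki-Birula theory; no Maxwell limit\<close>
     (\<forall>G\<in>{gBB_complex, gBB_flip_complex}.
        (\<forall>h c p. (h \<longlongrightarrow> c) (at 0) \<longrightarrow>
           ((\<lambda>\<psi>. G h p \<psi>) \<longlongrightarrow> bialynicki_birula p + of_real c) (at 0)) \<and>
        (\<forall>(F :: 'i filter) h \<psi> (a :: 'i \<Rightarrow> complex) b. F \<noteq> bot \<longrightarrow>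
           \<not> maxwell_limit F (\<lambda>i s p. a i * G (h i) (b i * p) (\<psi> i)))) \<and>
     topological_term bialynicki_birula \<and>
     \<comment> \<open>weak-field expansions\<close>
     (\<exists>r \<in> O[at_right 0](\<lambda>y. y ^ 3). \<forall>p \<psi>. \<forall>y\<in>{0<..<1}. y = p / \<psi> \<and> \<psi> > 0 \<longrightarrow>
        gBB (\<lambda>_. 0) p \<psi> = 2 * \<psi> * sqrt y * (1 - y / 6 - y\<^sup>2 / 40 + r y)) \<and>
     (\<exists>r \<in> O[at_right 0](\<lambda>y. y ^ 3). \<forall>p \<psi>. \<forall>y\<in>{0<..<1}. y = p / \<psi> \<and> \<psi> < 0 \<longrightarrow>
        gBB (\<lambda>_. 0) p \<psi> = 2 * \<psi> * y powr (3/2) / 3 * (1 + 3 * y / 10 + 9 * y\<^sup>2 / 56 + r y))"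
proof -
  have pos: "\<forall>(s, p, \<psi>) \<in> \<Omega>. 1 * \<psi> > 0" if "\<forall>(s, p, \<psi>) \<in> \<Omega>. \<psi> > 0" for \<Omega> :: "(real \<times> real \<times> real) set"
    using that by simp
  have neg: "\<forall>(s, p, \<psi>) \<in> \<Omega>. - 1 * \<psi> > 0" if "\<forall>(s, p, \<psi>) \<in> \<Omega>. \<psi> < 0" for \<Omega> :: "(real \<times> real \<times> real) set"
    using that by auto
  have one: "(1 :: real) \<in> {1, -1}" "(- 1 :: real) \<in> {1, -1}" by simp_all
  \<comment> \<open>The values \<open>e = 1\<close> and \<open>e = -1\<close> specialize the signed
    results to the two signs of \<psi>.\<close>
  note gBB = general_solutions[OF _ one(1) pos, folded gBB_eq_signed]
  note gBB_flip = general_solutions[OF _ one(2) neg, folded gBB_flip_eq_signed]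
  note complex_eq = gBB_complex_eq_signed gBB_flip_complex_eq_signed
  have independent_of_p: "\<not> (\<exists>L. nled_theory \<Omega> L \<and> independent_of_p \<Omega> L \<and> duality_invariant \<Omega> L)"
    if "nled_domain \<Omega>" for \<Omega>
    using not_duality_invariant_if_independent_of_p[OF that] by blast
  have reduced: "duality_invariant \<Omega> L \<longleftrightarrow> (\<forall>(s, p, \<psi>) \<in> \<Omega>. - p * (D\<^sub>p L s p \<psi>)\<^sup>2 + \<psi> = p)"
    if "nled_domain \<Omega>" "nled_theory \<Omega> L \<and> independent_of_s \<Omega> L" for \<Omega> L
    using that by (intro duality_invariant_iff_reduced D_s_eq_0_if_independent_of_s(2)[of \<Omega>]) auto
  have reality: "gBB_complex h p \<psi> \<in> \<real> \<longleftrightarrow> p * (\<psi> - p) \<ge> 0"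
    "gBB_flip_complex h p \<psi> \<in> \<real> \<longleftrightarrow> p * (\<psi> - p) \<ge> 0" for h p \<psi>
    unfolding complex_eq by (rule gBB_signed_complex_in_Reals_iff; simp)+
  have real_values: "gBB_complex h p \<psi> = of_real (gBB h p \<psi>) \<and>
      gBB_flip_complex h p \<psi> = of_real (gBB_flip h p \<psi>)" if "p * (\<psi> - p) \<ge> 0" for h p \<psi>
    unfolding complex_eq gBB_signed_complex_eq_of_real[OF that] gBB_def gBB_flip_def by simp
  have homogeneous: "(\<lambda>s'. L s' p \<psi>) field_differentiable at s \<and>
           (\<lambda>p'. L s p' \<psi>) field_differentiable at p \<and>
           (\<lambda>\<psi>'. L s p \<psi>') field_differentiable at \<psi> \<and>
           s * D\<^sub>s L s p \<psi> + p * D\<^sub>p L s p \<psi> + \<psi> * D\<^sub>\<psi> L s p \<psi> = L s p \<psi>"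
    if "linear h" "L \<in> {(\<lambda>s. gBB h), (\<lambda>s. gBB_flip h)}" "p * (\<psi> - p) > 0" for h L s p \<psi>
    using that(2) gBB_signed_homogeneous[OF that(1,3)]
    unfolding gBB_eq_signed gBB_flip_eq_signed by blast
  have limit: "((\<lambda>\<psi>. G h p \<psi>) \<longlongrightarrow> bialynicki_birula p + of_real c) (at 0)"
    if "G \<in> {gBB_complex, gBB_flip_complex}" "(h \<longlongrightarrow> c) (at 0)" for G h c p
    using that(1) gBB_signed_complex_tendsto_bialynicki_birula[OF that(2)]
    unfolding complex_eq by blast
  show ?thesis
    apply (intro conjI)
    subgoal by (intro allI impI conjI independent_of_p reduced gBB gBB_flip; (elim conjE)?; assumption)
    subgoal by (simp add: reality real_values)
    subgoal by (intro allI impI ballI homogeneous)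
    subgoal by (intro ballI conjI allI impI limit no_maxwell_limit_if_independent_of_s)
    by (rule topological_term_bialynicki_birula gBB_weak_field_pos gBB_weak_field_neg)+
qed

end
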